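(* Let $\mathbb{E}$ be a finite-dimensional real inner product space. Assume the following. (1) $h:\mathbb{E}\to(-\infty,+\infty]$ is of Legendre type and strongly convex, with $\overline{\mathrm{dom}\,h}=\mathrm{dom}\,h$. (2) $R:\mathbb{E}\to[0,+\infty]$ is proper, lsc and convex with $\mathrm{dom}\,\partial R\supset\mathrm{int}\,\mathrm{dom}\,h$ and $\mathrm{dom}\,R\cap\mathrm{int}\,\mathrm{dom}\,h\ne\emptyset$. (3) $E:\mathbb{E}\to(-\infty,+\infty]$ (possibly nonconvex) is proper and lsc with $\mathrm{dom}\,E\supset\mathrm{dom}\,h$, differentiable on $\mathrm{int}\,\mathrm{dom}\,h$ and continuous on $\mathrm{dom}\,h$; $L>0$ is such that $Lh-E$ is convex on $\mathrm{int}\,\mathrm{dom}\,h$. (4) $\beta\ge0$ and, with $f_\beta:=E+\beta R$, $\inf_{x\in\mathrm{dom}\,h}f_\beta(x)>-\infty$. (5) If $\{y^k\}\subset\mathrm{int}\,\mathrm{dom}\,h$ converges to some $x\in\mathrm{dom}\,h$, then $D_h(x,y^k)\to0$ and $D_R(x,y^k)\to0$. (6) For every bounded $U\subset\mathbb{E}$ there is $C>0$ such that $\|p\|\le C$ for all $x\in U$ and all $p\in\partial R(x)$. (7) $h$ and $E$ are locally gradient-Lipschitz-continuous. (8) The level set $\{x:f_\beta(x)\le f_\beta(x^0)\}$ is bounded. (9) $\mu>0$, and the parameters satisfy: $0<\delta^k<\frac{1+\alpha(h)-\omega}{L}$ for all $k$, for some $\omega\in(0,1+\alpha(h))$; $0<\tau<\delta^{k+1}\mu^{k+1}\le\delta^k\mu^k$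 for all $k\ge0$, for some $\tau$; $\mu^k\ge\mu$ for all $k$; and $\sum_{k=0}^\infty(\mu^k-\mu)<\infty$. (10) $F_{\beta,\mu}(x,y):=E(x)+(\beta+\mu)R(x)+\mu R^*(y)-\mu\langle x,y\rangle$ is a KL function on $\mathbb{E}\times\mathbb{E}$. Let $\{(x^k,p^k)\}$ be generated by the LBreIF iteration with these parameters. Then: (a) $\sum_{k=0}^\infty\|x^{k+1}-x^k\|<\infty$. (b) If $\beta=0$, then $\{x^k\}$ converges to a critical point $x^*$ of $E$, in the sense that $\nabla E(x^* )=0$. (c) If $R^*$ is locally strongly convex, then $\{p^k\}$ also converges, and the limit $x^*$ of $\{x^k\}$ is a critical point of $f_\beta$, in the sense that $0\in\nabla E(x^* )+\beta\,\partial R(x^* )$.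
   Context: Legendre type: a proper lsc convex $h$ is essentially smooth if $\mathrm{int}\,\mathrm{dom}\,h\ne\emptyset$, $h$ is differentiable on $\mathrm{int}\,\mathrm{dom}\,h$, and $\|\nabla h(y^k)\|\to\infty$ for every sequence in $\mathrm{int}\,\mathrm{dom}\,h$ converging to a boundary point of $\mathrm{dom}\,h$; it is of Legendre type if moreover it is strictly convex on $\mathrm{int}\,\mathrm{dom}\,h$. Bregman distances: $D_h(x,y)=h(x)-h(y)-\langle\nabla h(y),x-y\rangle$ for $x\in\mathrm{dom}\,h$, $y\in\mathrm{int}\,\mathrm{dom}\,h$. For $q\in\partial R(y)$, $D_R^{q}(x,y)=R(x)-R(y)-\langle q,x-y\rangle$; $D_R(x,y)$ suppresses the superscript. At iterates $y=x^k$ the subgradient is $p^k$; in hypothesis (5) the convergence is for every choice of subgradients at $y^k$. Symmetry coefficient: $\alpha(h)=\inf\{D_h(x,y)/D_h(y,x):x,y\in\mathrm{int}\,\mathrm{dom}\,h,\ x\ne y\}\in[0,1]$. $f$ is locally gradient-Lipschitz-continuous if for every bounded set $U\subset\mathrm{int}\,\mathrm{dom}\,f$ there is $L_f>0$ with $\|\nabla f(x)-\nabla f(y)\|\le L_f\|x-y\|$ for all $x,y\in U$. $R^*$ is the convex conjugate of $R$; locally strongly convex means strongly convex on every bounded convex subset of its domain (with modulus depending on the subset). LBreIF iteration with parameters $\delta^k>0$, $\mu^k>0$, $\beta\ge0$: start from $x^0\in\mathrm{int}\,\mathrm{dom}\,h$, $p^0\in\partial R(x^0)$, and for $k\ge0$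 $$x^{k+1}=\arg\min_x\Big\{\langle\nabla E(x^k),x-x^k\rangle+\beta R(x)+\tfrac1{\delta^k}D_h(x,x^k)+\mu^kD_R^{p^k}(x,x^k)\Big\},$$ $$p^{k+1}=\tfrac{\mu^k}{\mu^k+\beta}p^k-\tfrac1{\delta^k(\mu^k+\beta)}\big[\nabla h(x^{k+1})-\nabla h(x^k)+\delta^k\nabla E(x^k)\big].$$ The iteration is assumed well defined: the minimizer exists, is unique, and lies in $\mathrm{int}\,\mathrm{dom}\,h$; then $p^{k}\in\partial R(x^{k})$ for all $k$. KL function: a proper lsc $\sigma$ has the Kurdyka–Łojasiewicz property at $x^*\in\mathrm{dom}\,\partial\sigma$ ($\partial$ the limiting subdifferential) if there exist $\eta\in(0,+\infty]$, a neighborhood $U$ of $x^*$ and a continuous concave $\varphi:[0,\eta)\to\mathbb{R}_+$ with $\varphi(0)=0$, $\varphi\in C^1(0,\eta)$, $\varphi'>0$ on $(0,\eta)$, such that $\varphi'(\sigma(x)-\sigma(x^* ))\,\mathrm{dist}(0,\partial\sigma(x))\ge1$ for all $x\in U$ with $\sigma(x^* )<\sigma(x)<\sigma(x^* )+\eta$. $\sigma$ is a KL function if this holds at every point of $\mathrm{dom}\,\partial\sigma$. *)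

theory Defs
  imports "HOL-Analysis.Analysis"
begin

text \<open>
  A function with values in \<open>(-\<infinity>, +\<infinity>]\<close> is a map into \<^typ>\<open>ereal\<close> satisfying
  \<open>proper_fun\<close>.  Isabelle's \<^typ>\<open>ereal\<close> multiplication has \<open>0 * \<infinity> = 0\<close>, so \<open>0 * R\<close> is the
  zero function even outside the domain of \<open>R\<close>.
\<close>

definition edom :: "('a \<Rightarrow> ereal) \<Rightarrow> 'a set" where
  "edom f = {x. f x < \<infinity>}"

definition proper_fun :: "('a \<Rightarrow> ereal) \<Rightarrow> bool" where
  "proper_fun f \<longleftrightarrow> (\<forall>x. f x \<noteq> -\<infinity>) \<and> edom f \<noteq> {}"

definition lsc_fun :: "('a::topological_space \<Rightarrow> ereal) \<Rightarrow> bool" where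
  "lsc_fun f \<longleftrightarrow> (\<forall>x. f x \<le> Liminf (at x) f)"

definition econvex :: "('a::real_vector \<Rightarrow> ereal) \<Rightarrow> bool" where
  "econvex f \<longleftrightarrow> convex_on (edom f) (\<lambda>x. real_of_ereal (f x))"

definition strictly_convex_on :: "'a::real_vector set \<Rightarrow> ('a \<Rightarrow> real) \<Rightarrow> bool" where
  "strictly_convex_on S f \<longleftrightarrow> convex S \<and>
     (\<forall>x\<in>S. \<forall>y\<in>S. \<forall>t. x \<noteq> y \<longrightarrow> 0 < t \<longrightarrow> t < 1 \<longrightarrow>
        f ((1 - t) *\<^sub>R x + t *\<^sub>R y) < (1 - t) * f x + t * f y)"

definition strongly_convex_on :: "'a::real_normed_vector set \<Rightarrow> ('a \<Rightarrow> real) \<Rightarrow> bool" where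
  "strongly_convex_on S f \<longleftrightarrow> convex S \<and>
     (\<exists>c>0. \<forall>x\<in>S. \<forall>y\<in>S. \<forall>t\<in>{0..1}.
        f ((1 - t) *\<^sub>R x + t *\<^sub>R y)
          \<le> (1 - t) * f x + t * f y - c / 2 * t * (1 - t) * (norm (x - y))\<^sup>2)"

definition locally_strongly_convex :: "('a::real_normed_vector \<Rightarrow> ereal) \<Rightarrow> bool" where
  "locally_strongly_convex f \<longleftrightarrow>
     (\<forall>S. S \<subseteq> edom f \<longrightarrow> bounded S \<longrightarrow> convex S \<longrightarrow> strongly_convex_on S (\<lambda>x. real_of_ereal (f x)))"

text \<open>
  Gradients are taken only at interior points of the domain, where \<^const>\<open>real_of_ereal\<close> loses
  nothing for a proper function.
\<close>

definition has_egrad :: "('a::real_inner \<Rightarrow> ereal) \<Rightarrow> 'a \<Rightarrow> 'a \<Rightarrow> bool" where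
  "has_egrad f x g \<longleftrightarrow> x \<in> interior (edom f) \<and> (GDERIV (\<lambda>z. real_of_ereal (f z)) x :> g)"

definition egrad :: "('a::real_inner \<Rightarrow> ereal) \<Rightarrow> 'a \<Rightarrow> 'a" where
  "egrad f x = (THE g. has_egrad f x g)"

definition ediff_on :: "'a::real_inner set \<Rightarrow> ('a \<Rightarrow> ereal) \<Rightarrow> bool" where
  "ediff_on S f \<longleftrightarrow> (\<forall>x\<in>S. \<exists>g. has_egrad f x g)"

definition essentially_smooth :: "('a::real_inner \<Rightarrow> ereal) \<Rightarrow> bool" where
  "essentially_smooth h \<longleftrightarrow>
     interior (edom h) \<noteq> {} \<and> ediff_on (interior (edom h)) h \<and>
     (\<forall>y z. (\<forall>k. y k \<in> interior (edom h)) \<longrightarrow> z \<in> frontier (edom h) \<longrightarrow> y \<longlonglongrightarrow> z \<longrightarrow>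
        filterlim (\<lambda>k. norm (egrad h (y k))) at_top sequentially)"

definition legendre_type :: "('a::real_inner \<Rightarrow> ereal) \<Rightarrow> bool" where
  "legendre_type h \<longleftrightarrow> proper_fun h \<and> lsc_fun h \<and> econvex h \<and> essentially_smooth h \<and>
     strictly_convex_on (interior (edom h)) (\<lambda>x. real_of_ereal (h x))"

definition loc_grad_lipschitz :: "('a::real_inner \<Rightarrow> ereal) \<Rightarrow> bool" where
  "loc_grad_lipschitz f \<longleftrightarrow> ediff_on (interior (edom f)) f \<and>
     (\<forall>U. bounded U \<longrightarrow> U \<subseteq> interior (edom f) \<longrightarrow>
        (\<exists>Lf>0. \<forall>x\<in>U. \<forall>y\<in>U. norm (egrad f x - egrad f y) \<le> Lf * norm (x - y)))"

definition convex_subdiff :: "('a::real_inner \<Rightarrow> ereal) \<Rightarrow> 'a \<Rightarrow> 'a set" where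
  "convex_subdiff R x = {p. x \<in> edom R \<and> (\<forall>z. R x + ereal (p \<bullet> (z - x)) \<le> R z)}"

definition convex_conjugate :: "('a::real_inner \<Rightarrow> ereal) \<Rightarrow> 'a \<Rightarrow> ereal" where
  "convex_conjugate R y = (SUP x. ereal (x \<bullet> y) - R x)"

text \<open>
  Bregman distances are \<^typ>\<open>ereal\<close>-valued in order to be \<open>+\<infinity>\<close> when the first argument lies
  outside the domain; the second argument has to lie in the domain.
\<close>

definition bregman_sub :: "('a::real_inner \<Rightarrow> ereal) \<Rightarrow> 'a \<Rightarrow> 'a \<Rightarrow> 'a \<Rightarrow> ereal" where
  "bregman_sub R q x y = R x - R y - ereal (q \<bullet> (x - y))"

definition bregman :: "('a::real_inner \<Rightarrow> ereal) \<Rightarrow> 'a \<Rightarrow> 'a \<Rightarrow> ereal" where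
  "bregman h x y = bregman_sub h (egrad h y) x y"

definition sym_coeff :: "('a::real_inner \<Rightarrow> ereal) \<Rightarrow> real" where
  "sym_coeff h = Inf {real_of_ereal (bregman h x y) / real_of_ereal (bregman h y x) | x y.
     x \<in> interior (edom h) \<and> y \<in> interior (edom h) \<and> x \<noteq> y}"

definition lbreif_objective ::
  "('a::real_inner \<Rightarrow> ereal) \<Rightarrow> ('a \<Rightarrow> ereal) \<Rightarrow> ('a \<Rightarrow> ereal) \<Rightarrow> real \<Rightarrow> real \<Rightarrow> real \<Rightarrow>
     'a \<Rightarrow> 'a \<Rightarrow> 'a \<Rightarrow> ereal" where
  "lbreif_objective h R E \<beta> \<delta> \<mu> xk pk x =
     ereal (egrad E xk \<bullet> (x - xk)) + ereal \<beta> * R x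
       + ereal (1 / \<delta>) * bregman h x xk + ereal \<mu> * bregman_sub R pk x xk"

text \<open>
  The first three conjuncts of the recursion step express that the iteration is well defined:
  the subproblem has a unique minimizer over the whole space, and it lies in the interior of the
  domain of \<open>h\<close>.
\<close>

definition lbreif_iteration ::
  "('a::real_inner \<Rightarrow> ereal) \<Rightarrow> ('a \<Rightarrow> ereal) \<Rightarrow> ('a \<Rightarrow> ereal) \<Rightarrow> real \<Rightarrow>
     (nat \<Rightarrow> real) \<Rightarrow> (nat \<Rightarrow> real) \<Rightarrow> (nat \<Rightarrow> 'a) \<Rightarrow> (nat \<Rightarrow> 'a) \<Rightarrow> bool" where
  "lbreif_iteration h R E \<beta> \<delta> \<mu> x p \<longleftrightarrow>
     x 0 \<in> interior (edom h) \<and> p 0 \<in> convex_subdiff R (x 0) \<and>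
     (\<forall>k. is_arg_min (lbreif_objective h R E \<beta> (\<delta> k) (\<mu> k) (x k) (p k)) (\<lambda>_. True) (x (Suc k)) \<and>
          (\<forall>z. is_arg_min (lbreif_objective h R E \<beta> (\<delta> k) (\<mu> k) (x k) (p k)) (\<lambda>_. True) z
                 \<longrightarrow> z = x (Suc k)) \<and>
          x (Suc k) \<in> interior (edom h) \<and>
          p (Suc k) = (\<mu> k / (\<mu> k + \<beta>)) *\<^sub>R p k
            - (1 / (\<delta> k * (\<mu> k + \<beta>))) *\<^sub>R
                (egrad h (x (Suc k)) - egrad h (x k) + \<delta> k *\<^sub>R egrad E (x k)))"

definition frechet_subdiff :: "('a::real_inner \<Rightarrow> ereal) \<Rightarrow> 'a \<Rightarrow> 'a set" where
  "frechet_subdiff f x = {v. x \<in> edom f \<and>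
     0 \<le> Liminf (at x) (\<lambda>y. (f y - f x - ereal (v \<bullet> (y - x))) / ereal (norm (y - x)))}"

definition limiting_subdiff :: "('a::real_inner \<Rightarrow> ereal) \<Rightarrow> 'a \<Rightarrow> 'a set" where
  "limiting_subdiff f x = {v. x \<in> edom f \<and>
     (\<exists>y w. y \<longlonglongrightarrow> x \<and> (\<lambda>k. f (y k)) \<longlonglongrightarrow> f x \<and>
            (\<forall>k. w k \<in> frechet_subdiff f (y k)) \<and> w \<longlonglongrightarrow> v)}"

text \<open>Unlike \<^const>\<open>infdist\<close>, this distance is \<open>+\<infinity>\<close> for the empty set.\<close>

definition edist_set :: "'a::metric_space \<Rightarrow> 'a set \<Rightarrow> ereal" where
  "edist_set x S = (INF y\<in>S. ereal (dist x y))"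

definition KL_at :: "('a::real_inner \<Rightarrow> ereal) \<Rightarrow> 'a \<Rightarrow> bool" where
  "KL_at f xs \<longleftrightarrow>
     (\<exists>(\<eta>::ereal) U (\<phi>::real \<Rightarrow> real) \<phi>'.
        0 < \<eta> \<and> open U \<and> xs \<in> U \<and>
        continuous_on {t. 0 \<le> t \<and> ereal t < \<eta>} \<phi> \<and>
        concave_on {t. 0 \<le> t \<and> ereal t < \<eta>} \<phi> \<and>
        (\<forall>t. 0 \<le> t \<and> ereal t < \<eta> \<longrightarrow> 0 \<le> \<phi> t) \<and>
        \<phi> 0 = 0 \<and>
        (\<forall>t. 0 < t \<and> ereal t < \<eta> \<longrightarrow> (\<phi> has_real_derivative \<phi>' t) (at t) \<and> 0 < \<phi>' t) \<and>
        continuous_on {t. 0 < t \<and> ereal t < \<eta>} \<phi>' \<and>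
        (\<forall>x\<in>U. f xs < f x \<and> f x < f xs + \<eta> \<longrightarrow>
           1 \<le> ereal (\<phi>' (real_of_ereal (f x - f xs))) * edist_set 0 (limiting_subdiff f x)))"

definition KL_function :: "('a::real_inner \<Rightarrow> ereal) \<Rightarrow> bool" where
  "KL_function f \<longleftrightarrow> proper_fun f \<and> lsc_fun f \<and>
     (\<forall>x. limiting_subdiff f x \<noteq> {} \<longrightarrow> KL_at f x)"

definition f_reg :: "('a \<Rightarrow> ereal) \<Rightarrow> ('a \<Rightarrow> ereal) \<Rightarrow> real \<Rightarrow> 'a \<Rightarrow> ereal" where
  "f_reg E R \<beta> x = E x + ereal \<beta> * R x"

definition F_surrogate ::
  "('a::real_inner \<Rightarrow> ereal) \<Rightarrow> ('a \<Rightarrow> ereal) \<Rightarrow> real \<Rightarrow> real \<Rightarrow> 'a \<times> 'a \<Rightarrow> ereal" where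
  "F_surrogate E R \<beta> \<mu> = (\<lambda>(x, y).
     E x + ereal (\<beta> + \<mu>) * R x + ereal \<mu> * convex_conjugate R y - ereal (\<mu> * (x \<bullet> y)))"

end

theory Submission
  imports Defs
begin

text \<open>
  Essential smoothness together with local Lipschitz continuity of the gradient forces
  \<open>dom h\<close> to be the whole space, so every function involved is real-valued.  Testing the optimality
  condition with \<open>x\<^sup>k\<^sup>+\<^sup>1 - x\<^sup>k\<close> shows that \<open>f\<^sub>\<beta> (x\<^sup>k\<^sup>+\<^sup>1) + \<mu> D\<^sub>R (x\<^sup>k\<^sup>+\<^sup>1, x\<^sup>k)\<close>, which is the value of the
  surrogate at \<open>(x\<^sup>k\<^sup>+\<^sup>1, p\<^sup>k)\<close>, decreases by at least a multiple of the squared step.  At this point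
  the surrogate has a Frechet subgradient whose norm is at most a multiple of the step plus a multiple
  of the summable error \<open>\<mu>\<^sup>k - \<mu>\<close>, so the Kurdyka-Lojasiewicz inequality gives finite length of \<open>x\<close>,
  although nothing is known about the length of \<open>p\<close>.  The limit is identified from the update
  formula for \<open>p\<close>.
\<close>

subsection \<open>Convexity and gradients\<close>

text \<open>The limit passage behind the convexity arguments below: \<open>D t\<close> is a
  difference quotient along a segment, \<open>d\<close> is the strong convexity gain, and its factor
  \<open>1 - t\<close> tends to 1.\<close>

lemma tendsto_at_right_segment_le:
  fixes D :: "real \<Rightarrow> real"
  assumes "(D \<longlongrightarrow> a) (at_right 0)" and "\<And>t. 0 < t \<Longrightarrow> t < 1 \<Longrightarrow> D t \<le> b - (1 - t) * d"
  shows "a \<le> b - d"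
proof (rule tendsto_le[OF _ _ assms(1)])
  show "((\<lambda>t. b - (1 - t) * d) \<longlongrightarrow> b - d) (at_right (0::real))"
    by (auto intro!: tendsto_eq_intros)
  show "\<forall>\<^sub>F t in at_right (0::real). D t \<le> b - (1 - t) * d"
    using eventually_at_right_real[OF zero_less_one] by eventually_elim (use assms(2) in auto)
qed simp

lemma gderiv_directional:
  fixes f :: "'a::real_inner \<Rightarrow> real"
  assumes "GDERIV f y :> g"
  shows "((\<lambda>t. (f ((1 - t) *\<^sub>R y + t *\<^sub>R z) - f y) / t) \<longlongrightarrow> g \<bullet> (z - y)) (at_right 0)"
proof -
  have lin: "((\<lambda>t. y + t *\<^sub>R (z - y)) has_derivative (\<lambda>t. t *\<^sub>R (z - y))) (at (0::real))"
    by (auto intro!: derivative_eq_intros)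
  have "(f has_derivative (\<lambda>v. v \<bullet> g)) (at (y + (0::real) *\<^sub>R (z - y)))"
    using assms by (simp add: gderiv_def)
  from has_derivative_compose[OF lin this]
  have "((\<lambda>t. f (y + t *\<^sub>R (z - y))) has_field_derivative (g \<bullet> (z - y))) (at 0)"
    unfolding has_field_derivative_def
    by (rule back_subst[of "\<lambda>F. (_ has_derivative F) _"]) (simp add: fun_eq_iff inner_commute)
  moreover have "y + t *\<^sub>R (z - y) = (1 - t) *\<^sub>R y + t *\<^sub>R z" for t
    by (simp add: algebra_simps)
  ultimately have "((\<lambda>t. f ((1 - t) *\<^sub>R y + t *\<^sub>R z)) has_field_derivative (g \<bullet> (z - y))) (at 0)"
    by simp
  then have "((\<lambda>t. (f ((1 - t) *\<^sub>R y + t *\<^sub>R z) - f y) / t) \<longlongrightarrow> g \<bullet> (z - y)) (at 0)"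
    by (simp add: has_field_derivative_iff)
  then show ?thesis
    by (rule tendsto_mono[rotated]) (simp add: at_le)
qed

text \<open>Divide the convexity inequality by \<open>t\<close> and let \<open>t\<close> decrease to
  0. With \<open>c = 0\<close> this is the plain tangent inequality, applied later to
  \<open>L * H - Er\<close>.\<close>

lemma gderiv_strong_tangent:
  fixes f :: "'a::real_inner \<Rightarrow> real"
  assumes "GDERIV f y :> g"
    and "\<And>t. 0 < t \<Longrightarrow> t < 1 \<Longrightarrow> f ((1 - t) *\<^sub>R y + t *\<^sub>R z)
          \<le> (1 - t) * f y + t * f z - c / 2 * t * (1 - t) * (norm (y - z))\<^sup>2"
  shows "f y + g \<bullet> (z - y) + c / 2 * (norm (z - y))\<^sup>2 \<le> f z"
proof -
  have "g \<bullet> (z - y) \<le> (f z - f y) - c / 2 * (norm (y - z))\<^sup>2"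
  proof (rule tendsto_at_right_segment_le[OF gderiv_directional[OF assms(1)]])
    fix t :: real assume t: "0 < t" "t < 1"
    show "(f ((1 - t) *\<^sub>R y + t *\<^sub>R z) - f y) / t \<le> f z - f y - (1 - t) * (c / 2 * (norm (y - z))\<^sup>2)"
    proof -
      have "f ((1 - t) *\<^sub>R y + t *\<^sub>R z) - f y \<le> (f z - f y - (1 - t) * (c / 2 * (norm (y - z))\<^sup>2)) * t"
        using assms(2)[OF t] by (simp add: field_simps)
      then show ?thesis using t(1) by (simp only: pos_divide_le_eq)
    qed
  qed
  then show ?thesis by (simp add: norm_minus_commute)
qed

text \<open>Fermat's rule for a sum: towards \<open>z\<close>, convexity makes the increment of
  \<open>f\<close> at most linear in \<open>t\<close>, so minimality forces \<open>- g\<close> to be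
  a subgradient of \<open>f\<close>, with no sum rule for subdifferentials.\<close>

lemma minimizer_convex_plus_smooth:
  fixes f \<psi> :: "'a::real_inner \<Rightarrow> real"
  assumes f: "convex_on UNIV f" and \<psi>: "GDERIV \<psi> u :> g" and min: "\<And>z. f u + \<psi> u \<le> f z + \<psi> z"
  shows "f u - g \<bullet> (z - u) \<le> f z"
proof -
  have "- (g \<bullet> (z - u)) \<le> (f z - f u) - 0"
  proof (rule tendsto_at_right_segment_le[OF tendsto_minus[OF gderiv_directional[OF \<psi>]]])
    fix t :: real assume t: "0 < t" "t < 1"
    have "f ((1 - t) *\<^sub>R u + t *\<^sub>R z) \<le> (1 - t) * f u + t * f z"
      using f t by (simp add: convex_on_def)
    then have "t * (f z - f u) \<ge> - (\<psi> ((1 - t) *\<^sub>R u + t *\<^sub>R z) - \<psi> u)"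
      using min[of "(1 - t) *\<^sub>R u + t *\<^sub>R z"] by (simp add: algebra_simps)
    then show "- ((\<psi> ((1 - t) *\<^sub>R u + t *\<^sub>R z) - \<psi> u) / t) \<le> f z - f u - (1 - t) * 0"
      using t by (simp add: field_simps)
  qed
  then show ?thesis by simp
qed

lemma has_egrad_unique:
  assumes "has_egrad f x g" "has_egrad f x g'"
  shows "g = g'"
proof -
  have "(\<lambda>v. v \<bullet> g) = (\<lambda>v. v \<bullet> g')"
    using assms unfolding has_egrad_def gderiv_def by (blast intro: has_derivative_unique)
  then have "v \<bullet> g = v \<bullet> g'" for v by metis
  from this[of "g - g'"] have "(g - g') \<bullet> (g - g') = 0" by (simp add: inner_diff_right)
  then show ?thesis by simp
qed

lemma has_egrad_egrad:
  assumes "ediff_on S f" "x \<in> S"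
  shows "has_egrad f x (egrad f x)"
  unfolding egrad_def
  using assms by (metis (mono_tags, lifting) ediff_on_def has_egrad_unique theI')

text \<open>Local Lipschitz continuity keeps the gradient bounded along any sequence approaching a
  boundary point, against essential smoothness.\<close>

lemma legendre_loc_grad_lipschitz_full_domain:
  fixes h :: "'a::euclidean_space \<Rightarrow> ereal"
  assumes leg: "legendre_type h" and lip: "loc_grad_lipschitz h"
  shows "edom h = UNIV"
proof (rule ccontr)
  assume "edom h \<noteq> UNIV"
  have ne: "interior (edom h) \<noteq> {}" and cv: "convex (edom h)"
    using leg by (auto simp: legendre_type_def essentially_smooth_def econvex_def intro: convex_on_imp_convex)
  then have "frontier (edom h) \<noteq> {}"
    using \<open>edom h \<noteq> UNIV\<close> interior_subset by (auto simp: frontier_eq_empty)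
  then obtain z where z: "z \<in> frontier (edom h)" by auto
  then have "z \<in> closure (interior (edom h))"
    using convex_closure_interior[OF cv ne] by (simp add: frontier_def)
  then obtain y where y: "\<And>k. y k \<in> interior (edom h)" "y \<longlonglongrightarrow> z"
    by (auto simp: closure_sequential)
  have lim: "filterlim (\<lambda>k. norm (egrad h (y k))) at_top sequentially"
    using leg y z by (auto simp: legendre_type_def essentially_smooth_def)
  have bd: "bounded (range y)" by (rule convergent_imp_bounded[OF y(2)])
  \<comment> \<open>One Lipschitz constant holds on every bounded subset of the interior, even on
    one like \<open>range y\<close> that accumulates at the boundary; the contradiction starts
    here.\<close>
  then obtain l where l: "l > 0" "\<And>i j. norm (egrad h (y i) - egrad h (y j)) \<le> l * norm (y i - y j)"
    using lip y(1) unfolding loc_grad_lipschitz_def by (metis image_subset_iff rangeI)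
  obtain B where B: "\<And>k. norm (y k) \<le> B" using bd by (auto simp: bounded_iff)
  have bdd: "norm (egrad h (y k)) \<le> norm (egrad h (y 0)) + l * (B + B)" for k
  proof -
    have "norm (y k - y 0) \<le> B + B"
      using norm_triangle_ineq4[of "y k" "y 0"] B[of k] B[of 0] by simp
    then have "norm (egrad h (y k) - egrad h (y 0)) \<le> l * (B + B)"
      using l(2)[of k 0] l(1) by (meson mult_left_mono order.trans less_imp_le)
    then show ?thesis using norm_triangle_sub[of "egrad h (y k)" "egrad h (y 0)"] by simp
  qed
  from lim have "eventually (\<lambda>k. norm (egrad h (y 0)) + l * (B + B) < norm (egrad h (y k))) sequentially"
    by (simp add: filterlim_at_top_dense)
  then show False using bdd by (metis eventually_happens' leD sequentially_bot)
qed

subsection \<open>Finite length from the Kurdyka-Lojasiewicz inequality\<close>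

text \<open>Summing the inequality from \<open>N\<close> on, the doubled left side absorbs the
  partial sum of \<open>d\<close> on the right and leaves the bound
  \<open>2 * d N + B\<close>.\<close>

lemma summable_of_halving:
  fixes d g :: "nat \<Rightarrow> real"
  assumes d: "\<And>k. 0 \<le> d k" and g: "summable g" and step: "\<And>k. N \<le> k \<Longrightarrow> 2 * d (Suc k) \<le> d k + g k"
  shows "summable d"
proof -
  have "summable (\<lambda>k. g (k + N))" using g by (simp add: summable_iff_shift)
  then obtain B where B: "\<And>n. (\<Sum>k<n. g (k + N)) \<le> B"
    using summable_imp_sums_bounded[of "\<lambda>k. g (k + N)"]
    by (auto simp: bounded_iff) (meson abs_le_D1)
  have "(\<Sum>k<n. d (k + N)) \<le> 2 * d N + B" for n
  proof -
    have "2 * ((\<Sum>k<Suc n. d (k + N)) - d N) = (\<Sum>k<n. 2 * d (Suc (k + N)))"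
      by (simp add: sum.lessThan_Suc_shift sum_distrib_left del: sum.lessThan_Suc)
    also have "\<dots> \<le> (\<Sum>k<n. d (k + N) + g (k + N))" by (intro sum_mono step) simp
    also have "\<dots> \<le> (\<Sum>k<n. d (k + N)) + B" using B[of n] by (simp add: sum.distrib)
    finally show ?thesis using d[of "n + N"] by (simp add: algebra_simps)
  qed
  then have "summable (\<lambda>k. d (k + N))" by (intro summableI_nonneg_bounded d)
  then show ?thesis by (simp add: summable_iff_shift)
qed

text \<open>In the direction \<open>v\<close> the increments eventually exceed the fixed amount
  \<open>v \<bullet> v / 2\<close>, so \<open>p k \<bullet> v\<close> would grow linearly.\<close>

lemma bounded_increments_limit_zero:
  fixes p :: "nat \<Rightarrow> 'a::real_inner"
  assumes p: "bounded (range p)" and lim: "(\<lambda>k. p (Suc k) - p k) \<longlonglongrightarrow> v"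
  shows "v = 0"
proof (rule ccontr)
  assume "v \<noteq> 0"
  define a where "a = (v \<bullet> v) / 2"
  have a: "a > 0" "a < v \<bullet> v" using \<open>v \<noteq> 0\<close> by (auto simp: a_def)
  have "(\<lambda>k. (p (Suc k) - p k) \<bullet> v) \<longlonglongrightarrow> v \<bullet> v" by (intro tendsto_intros lim)
  from order_tendstoD(1)[OF this a(2)] obtain N
    where N: "\<And>k. k \<ge> N \<Longrightarrow> a < (p (Suc k) - p k) \<bullet> v" by (auto simp: eventually_sequentially)
  have lin: "p N \<bullet> v + of_nat n * a \<le> p (N + n) \<bullet> v" for n
  proof (induction n)
    case (Suc n)
    then show ?case using N[of "N + n"] by (simp add: algebra_simps inner_diff_left)
  qed simp
  obtain B where B: "\<And>k. norm (p k) \<le> B" using p by (auto simp: bounded_iff)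
  have ub: "\<bar>p k \<bullet> v\<bar> \<le> B * norm v" for k
    by (rule order_trans[OF Cauchy_Schwarz_ineq2]) (simp add: B mult_right_mono)
  obtain n :: nat where "2 * (B * norm v) < of_nat n * a" using a(1) reals_Archimedean3 by blast
  then show False using lin[of n] ub[of N] ub[of "N + n"] by (simp add: abs_le_iff)
qed

text \<open>The dichotomy behind the cover argument: near a point that the sequence finally avoids
  nothing has to be shown, and any other point is a cluster point, where the KL inequality is
  available.\<close>

lemma eventually_avoid_or_subseq:
  fixes z :: "nat \<Rightarrow> 'a::metric_space"
  obtains (avoid) U where "open U" "l \<in> U" "\<forall>\<^sub>F k in sequentially. z k \<notin> U"
  | (subseq) r where "filterlim r at_top sequentially" "(\<lambda>n. z (r n)) \<longlonglongrightarrow> l"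
proof (cases "\<forall>e>0. \<forall>N. \<exists>k\<ge>N. dist (z k) l < e")
  case True
  then have "\<exists>k\<ge>n. dist (z k) l < 1 / real (Suc n)" for n
    by simp
  then obtain r where r: "\<And>n. r n \<ge> n" "\<And>n. dist (z (r n)) l < 1 / real (Suc n)" by metis
  have "filterlim r at_top sequentially"
    by (rule filterlim_at_top_mono[OF filterlim_ident]) (simp add: r)
  moreover have "(\<lambda>n. dist (z (r n)) l) \<longlonglongrightarrow> 0"
    by (rule tendsto_sandwich[OF _ _ tendsto_const LIMSEQ_Suc[OF lim_1_over_n]])
       (use r(2) in \<open>auto intro!: always_eventually less_imp_le\<close>)
  then have "(\<lambda>n. z (r n)) \<longlonglongrightarrow> l" using tendsto_dist_iff by blast
  ultimately show ?thesis by (rule subseq)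
next
  case False
  then obtain e N where "e > 0" "\<And>k. k \<ge> N \<Longrightarrow> \<not> dist (z k) l < e" by blast
  then show ?thesis
    by (intro avoid[of "ball l e"]) (auto simp: eventually_sequentially dist_commute)
qed

text \<open>By concavity, \<open>\<psi> k = \<phi> (F k - v)\<close> drops by at least
  \<open>\<phi>' (F k - v) * (F k - F (Suc k))\<close>, and KL bounds
  \<open>\<phi>' (F k - v) * norm (w k)\<close> below by 1. Monotonicity and sign of
  \<open>\<psi>\<close> are stated without \<open>z k \<in> U\<close>, since several such functions
  get added.\<close>

lemma KL_at_decrease:
  fixes f :: "'b::real_inner \<Rightarrow> ereal"
  assumes KL: "KL_at f l" and fl: "f l = ereal v"
    and f: "\<And>k. f (z k) = ereal (F k)" and w: "\<And>k. w k \<in> limiting_subdiff f (z k)"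
    and above: "\<And>k. v < F k" and dec: "decseq F" and F: "F \<longlonglongrightarrow> v"
  obtains U \<psi> where "open U" "l \<in> U"
    "\<forall>\<^sub>F k in sequentially. \<psi> (Suc k) \<le> \<psi> k \<and> (0::real) \<le> \<psi> k \<and>
       (z k \<in> U \<longrightarrow> F k - F (Suc k) \<le> (\<psi> k - \<psi> (Suc k)) * norm (w k))"
proof -
  obtain \<eta> :: ereal and U and \<phi> \<phi>' :: "real \<Rightarrow> real" where
    \<eta>: "0 < \<eta>" and U: "open U" "l \<in> U"
    and conc: "concave_on {t. 0 \<le> t \<and> ereal t < \<eta>} \<phi>"
    and \<phi>0: "\<And>t. 0 \<le> t \<Longrightarrow> ereal t < \<eta> \<Longrightarrow> 0 \<le> \<phi> t"
    and \<phi>': "\<And>t. 0 < t \<Longrightarrow> ereal t < \<eta> \<Longrightarrow> (\<phi> has_real_derivative \<phi>' t) (at t) \<and> 0 < \<phi>' t"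
    and ineq: "\<And>y. y \<in> U \<Longrightarrow> f l < f y \<Longrightarrow> f y < f l + \<eta> \<Longrightarrow>
        1 \<le> ereal (\<phi>' (real_of_ereal (f y - f l))) * edist_set 0 (limiting_subdiff f y)"
    using KL unfolding KL_at_def by blast
  define A where "A = {t. 0 \<le> t \<and> ereal t < \<eta>}"
  \<comment> \<open>Since \<open>\<eta>\<close> may be infinite, a finite \<open>e\<close> below it
    is used; in the open interval up to \<open>e\<close> every point is interior, as the tangent
    inequality requires.\<close>
  obtain e where e: "0 < ereal e" "ereal e < \<eta>"
    using ereal_dense2[OF \<eta>] by (metis zero_ereal_def)
  have sub: "{0<..<e} \<subseteq> A"
  proof
    fix t assume "t \<in> {0<..<e}"
    moreover from this have "ereal t < \<eta>" by (intro less_trans[OF _ e(2)]) simp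
    ultimately show "t \<in> A" by (simp add: A_def)
  qed
  have tangent: "\<phi>' s * (s - t) \<le> \<phi> s - \<phi> t" if "0 < s" "s < e" "0 < t" "t < e" for s t
  proof -
    have "convex_on {0<..<e} (\<lambda>t. - \<phi> t)"
      using conc sub unfolding concave_on_def A_def[symmetric] by (rule convex_on_subset) simp
    moreover have "ereal s < \<eta>" using that by (intro less_trans[OF _ e(2)]) simp
    then have "((\<lambda>t. - \<phi> t) has_field_derivative - \<phi>' s) (at s within {0<..<e})"
      using \<phi>'[of s] that(1) by (intro DERIV_minus) (meson DERIV_subset subset_UNIV)
    ultimately have "- \<phi> t - (- \<phi> s) \<ge> - \<phi>' s * (t - s)"
      using that by (intro convex_on_imp_above_tangent[of "{0<..<e}"]) (auto simp: interior_open)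
    then show ?thesis by (simp add: algebra_simps)
  qed
  define \<psi> where "\<psi> k = \<phi> (F k - v)" for k
  have ev: "\<forall>\<^sub>F k in sequentially. F k - v < e"
  proof -
    have "v < v + e" using e(1) by simp
    from order_tendstoD(2)[OF F this] show ?thesis by eventually_elim simp
  qed
  have "\<forall>\<^sub>F k in sequentially. \<psi> (Suc k) \<le> \<psi> k \<and> 0 \<le> \<psi> k \<and>
       (z k \<in> U \<longrightarrow> F k - F (Suc k) \<le> (\<psi> k - \<psi> (Suc k)) * norm (w k))"
    using ev
  proof eventually_elim
    case (elim k)
    have le: "F (Suc k) \<le> F k" using dec by (simp add: decseq_Suc_iff)
    have pos: "0 < F k - v" "0 < F (Suc k) - v" using above[of k] above[of "Suc k"] by auto
    have lt: "ereal (F k - v) < \<eta>" using elim e(2) by (metis less_ereal.simps(1) less_trans)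
    have tg: "\<phi>' (F k - v) * (F k - F (Suc k)) \<le> \<psi> k - \<psi> (Suc k)"
      using tangent[of "F k - v" "F (Suc k) - v"] elim le pos by (simp add: \<psi>_def)
    have dpos: "0 < \<phi>' (F k - v)" using \<phi>'[OF pos(1) lt] by simp
    have mono: "\<psi> (Suc k) \<le> \<psi> k"
    proof -
      have "0 \<le> \<phi>' (F k - v) * (F k - F (Suc k))" using dpos le by (intro mult_nonneg_nonneg) auto
      then show ?thesis using tg by linarith
    qed
    have "F k - F (Suc k) \<le> (\<psi> k - \<psi> (Suc k)) * norm (w k)" if zk: "z k \<in> U"
    proof -
      have "f (z k) < f l + \<eta>"
        using lt by (cases \<eta>) (auto simp: f fl)
      then have "1 \<le> ereal (\<phi>' (F k - v)) * edist_set 0 (limiting_subdiff f (z k))"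
        using ineq[OF zk] above[of k] by (simp add: f fl)
      also have "edist_set 0 (limiting_subdiff f (z k)) \<le> ereal (norm (w k))"
        unfolding edist_set_def using w[of k] by (rule INF_lower2) (simp add: dist_norm)
      then have "ereal (\<phi>' (F k - v)) * edist_set 0 (limiting_subdiff f (z k))
          \<le> ereal (\<phi>' (F k - v)) * ereal (norm (w k))"
        using dpos by (intro ereal_mult_left_mono) auto
      finally have "1 \<le> \<phi>' (F k - v) * norm (w k)" by (simp add: one_ereal_def)
      then have "(F k - F (Suc k)) * 1 \<le> (F k - F (Suc k)) * (\<phi>' (F k - v) * norm (w k))"
        using le by (intro mult_left_mono) auto
      also have "\<dots> \<le> (\<psi> k - \<psi> (Suc k)) * norm (w k)"
        using mult_right_mono[OF tg, of "norm (w k)"] by (simp add: ac_simps)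
      finally show ?thesis by simp
    qed
    then show ?case using mono \<phi>0[of "F k - v"] pos lt by (auto simp: \<psi>_def)
  qed
  with U show ?thesis by (rule that)
qed

text \<open>The desingularizing functions attached to a finite cover of the trajectory are added up, so
  that the trajectory itself need not stay close to any one cluster point.\<close>

lemma KL_finite_length:
  fixes f :: "'b::euclidean_space \<Rightarrow> ereal" and z w :: "nat \<Rightarrow> 'b" and F d e :: "nat \<Rightarrow> real"
  assumes bdd: "bounded (range z)"
    and cluster: "\<And>r l. filterlim r at_top sequentially \<Longrightarrow> (\<lambda>n. z (r n)) \<longlonglongrightarrow> l \<Longrightarrow>
          f l = ereal v \<and> KL_at f l"
    and f: "\<And>k. f (z k) = ereal (F k)" and F: "F \<longlonglongrightarrow> v"
    and w: "\<And>k. w k \<in> limiting_subdiff f (z k)"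
    and c: "0 < c" and dec: "\<And>k. F (Suc k) + c * (d k)\<^sup>2 \<le> F k"
    and b: "0 < b" and rel: "\<And>k. norm (w (Suc k)) \<le> b * d k + e k"
    and d: "\<And>k. 0 \<le> d k" and e: "summable e"
  shows "summable d"
proof -
  have Fdec: "decseq F" 
    unfolding decseq_Suc_iff using dec c by (meson add_le_same_cancel1 le_add_same_cancel1 mult_nonneg_nonneg order.trans less_imp_le zero_le_power2)
  have Fge: "v \<le> F k" for k using decseq_ge[OF Fdec F] .
  show ?thesis
  proof (cases "\<exists>N. F N = v")
    \<comment> \<open>If the limit value is attained, monotonicity freezes \<open>F\<close> from
      there on and the descent inequality makes all later steps zero.\<close>
    case True
    then obtain N where N: "F N = v" by blast
    have Fv: "F k = v" if "k \<ge> N" for k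
      using decseqD[OF Fdec that] N Fge[of k] by simp
    have "d k = 0" if "k \<ge> N" for k
      using dec[of k] Fv[of k] Fv[of "Suc k"] that c by (simp add: mult_le_0_iff)
    then have "summable (\<lambda>k. d (k + N))" by simp
    then show ?thesis by (simp only: summable_iff_shift)
  next
    case False
    then have above: "v < F k" for k using Fge[of k] by (metis order_le_less)
    define good where "good U \<psi> \<longleftrightarrow> (\<forall>\<^sub>F k in sequentially. \<psi> (Suc k) \<le> \<psi> k \<and> (0::real) \<le> \<psi> k \<and>
       (z k \<in> U \<longrightarrow> F k - F (Suc k) \<le> (\<psi> k - \<psi> (Suc k)) * norm (w k)))" for U \<psi>
    have "\<exists>U \<psi>. open U \<and> l \<in> U \<and> good U \<psi>" for l
    proof (cases rule: eventually_avoid_or_subseq[of l z])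
      case (avoid U)
      \<comment> \<open>The implication in \<open>good\<close> is eventually vacuous here, so the
        zero function serves.\<close>
      then have "good U (\<lambda>_. 0)" unfolding good_def by (auto elim!: eventually_mono)
      with avoid show ?thesis by blast
    next
      case (subseq r)
      from cluster[OF this] have "KL_at f l" "f l = ereal v" by auto
      show ?thesis
        using KL_at_decrease[of f l v z F w, OF \<open>KL_at f l\<close> \<open>f l = ereal v\<close> f w above Fdec F]
        unfolding good_def[symmetric] by blast
    qed
    then obtain U \<psi> where U: "\<And>l. open (U l)" "\<And>l. l \<in> U l" and good: "\<And>l. good (U l) (\<psi> l)"
      by metis
    have "compact (closure (range z))" using bdd by (simp add: compact_closure)
    moreover have "closure (range z) \<subseteq> (\<Union>l\<in>UNIV. U l)" using U(2) by blast
    ultimately obtain D where D: "finite D" "closure (range z) \<subseteq> (\<Union>l\<in>D. U l)"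
      using compactE_image[of "closure (range z)" UNIV U] U(1) by metis
    define \<Psi> where "\<Psi> k = (\<Sum>l\<in>D. \<psi> l k)" for k
    have "\<forall>\<^sub>F k in sequentially. \<forall>l\<in>D. \<psi> l (Suc k) \<le> \<psi> l k \<and> 0 \<le> \<psi> l k \<and>
       (z k \<in> U l \<longrightarrow> F k - F (Suc k) \<le> (\<psi> l k - \<psi> l (Suc k)) * norm (w k))"
      using D(1) good unfolding good_def by (intro eventually_ball_finite) auto
    then obtain N where N: "\<And>k l. k \<ge> N \<Longrightarrow> l \<in> D \<Longrightarrow> \<psi> l (Suc k) \<le> \<psi> l k \<and> 0 \<le> \<psi> l k \<and>
       (z k \<in> U l \<longrightarrow> F k - F (Suc k) \<le> (\<psi> l k - \<psi> l (Suc k)) * norm (w k))"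
      unfolding eventually_sequentially by blast
    have \<Psi>: "\<Psi> (Suc k) \<le> \<Psi> k" "0 \<le> \<Psi> k" "F k - F (Suc k) \<le> (\<Psi> k - \<Psi> (Suc k)) * norm (w k)"
      if k: "k \<ge> N" for k
    proof -
      show "\<Psi> (Suc k) \<le> \<Psi> k" "0 \<le> \<Psi> k"
        unfolding \<Psi>_def using N[OF k] by (auto intro!: sum_mono sum_nonneg)
      obtain l where l: "l \<in> D" "z k \<in> U l" using D(2) closure_subset by blast
      \<comment> \<open>All differences in the sum are nonnegative, so the one belonging to a set
        that contains \<open>z k\<close> is dominated by the total, whichever set this is.\<close>
      have "\<psi> l k - \<psi> l (Suc k) \<le> (\<Sum>l\<in>D. \<psi> l k - \<psi> l (Suc k))"
        using N[OF k] l D(1) by (intro member_le_sum) auto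
      also have "\<dots> = \<Psi> k - \<Psi> (Suc k)" by (simp add: \<Psi>_def sum_subtractf)
      finally have "(\<psi> l k - \<psi> l (Suc k)) * norm (w k) \<le> (\<Psi> k - \<Psi> (Suc k)) * norm (w k)"
        by (intro mult_right_mono) auto
      then show "F k - F (Suc k) \<le> (\<Psi> k - \<Psi> (Suc k)) * norm (w k)" using N[OF k l(1)] l(2) by force
    qed
    \<comment> \<open>\<open>g\<close> is what \<open>P + Q\<close> contains besides
      \<open>d k\<close> in the inequality \<open>2 * sqrt (P * Q) \<le> P + Q\<close> used below:
      the scaled error and a telescoping difference. The recursion arises because
      \<open>w (Suc k)\<close> is bounded by \<open>d k\<close> and in turn controls
      \<open>d (Suc k)\<close>.\<close>
    define g where "g k = e k / b + b / c * (\<Psi> (Suc k) - \<Psi> (Suc (Suc k)))" for k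
    have "2 * d (Suc k) \<le> d k + g k" if k: "k \<ge> N" for k
    proof -
      define P where "P = b / c * (\<Psi> (Suc k) - \<Psi> (Suc (Suc k)))"
      have P: "P \<ge> 0" using \<Psi>(1)[of "Suc k"] k b c by (simp add: P_def)
      define Q where "Q = d k + e k / b"
      have wQ: "norm (w (Suc k)) \<le> b * Q" using rel[of k] b by (simp add: Q_def distrib_left)
      \<comment> \<open>\<open>e k\<close> may be negative; \<open>Q \<ge> 0\<close> holds because
        \<open>b * Q\<close> bounds a norm.\<close>
      then have "0 \<le> b * Q" by (rule order_trans[OF norm_ge_zero])
      then have Q: "Q \<ge> 0" using b by (simp add: zero_le_mult_iff)
      have "c * (d (Suc k))\<^sup>2 \<le> F (Suc k) - F (Suc (Suc k))" using dec[of "Suc k"] by simp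
      also have "\<dots> \<le> (\<Psi> (Suc k) - \<Psi> (Suc (Suc k))) * norm (w (Suc k))" using \<Psi>(3)[of "Suc k"] k by simp
      also have "\<dots> \<le> (\<Psi> (Suc k) - \<Psi> (Suc (Suc k))) * (b * Q)"
        using \<Psi>(1)[of "Suc k"] k wQ by (intro mult_left_mono) auto
      also have "\<dots> = c * (P * Q)" using c by (simp add: P_def)
      finally have "(d (Suc k))\<^sup>2 \<le> P * Q" using c by simp
      then have "(2 * d (Suc k))\<^sup>2 \<le> (P + Q)\<^sup>2"
        using zero_le_power2[of "P - Q"] unfolding power2_eq_square by (simp add: algebra_simps)
      then have "2 * d (Suc k) \<le> P + Q" by (rule power2_le_imp_le) (use P Q in simp)
      then show ?thesis by (simp add: g_def P_def Q_def)
    qed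
    note step = this
    have "summable g"
    proof -
      have "decseq (\<lambda>k. \<Psi> (k + N))" using \<Psi>(1) by (simp add: decseq_Suc_iff)
      then obtain L where "(\<lambda>k. \<Psi> (k + N)) \<longlonglongrightarrow> L"
        using \<Psi>(2) by (auto intro: decseq_convergent[of "\<lambda>k. \<Psi> (k + N)" 0])
      then have "\<Psi> \<longlonglongrightarrow> L" by (rule LIMSEQ_offset)
      then have "(\<lambda>k. \<Psi> (Suc k)) \<longlonglongrightarrow> L" by (rule LIMSEQ_Suc)
      from telescope_summable'[OF this]
      have "summable (\<lambda>k. \<Psi> (Suc k) - \<Psi> (Suc (Suc k)))" .
      from summable_add[OF summable_divide[OF e, of b] summable_mult[OF this, of "b / c"]]
      show ?thesis unfolding g_def .
    qed
    from summable_of_halving[OF d this step] show ?thesis .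
  qed
qed

subsection \<open>The surrogate function\<close>

lemma mem_convex_subdiff_real:
  "p \<in> convex_subdiff (\<lambda>z. ereal (R z)) x \<longleftrightarrow> (\<forall>z. R x + p \<bullet> (z - x) \<le> R z)"
  by (simp add: convex_subdiff_def edom_def)

lemma convex_conjugate_ge: "ereal (u \<bullet> y - R u) \<le> convex_conjugate (\<lambda>z. ereal (R z)) y"
  unfolding convex_conjugate_def by (rule SUP_upper2[of u]) auto

text \<open>Equality in Fenchel-Young: by the subgradient inequality, \<open>u\<close> attains the
  supremum defining the conjugate.\<close>

lemma convex_conjugate_at_subgradient:
  assumes "y \<in> convex_subdiff (\<lambda>z. ereal (R z)) u"
  shows "convex_conjugate (\<lambda>z. ereal (R z)) y = ereal (u \<bullet> y - R u)"
proof (rule antisym[OF _ convex_conjugate_ge])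
  have "z \<bullet> y - R z \<le> u \<bullet> y - R u" for z
    using assms[unfolded mem_convex_subdiff_real] by (simp add: algebra_simps inner_commute)
       (metis add.commute add_le_cancel_left diff_add_cancel inner_commute)
  then show "convex_conjugate (\<lambda>z. ereal (R z)) y \<le> ereal (u \<bullet> y - R u)"
    unfolding convex_conjugate_def by (intro SUP_least) simp
qed

text \<open>A minorant that touches \<open>f\<close> at \<open>z\<close> and is differentiable there
  passes its gradient on. The smooth part \<open>\<Phi>\<close> and the linear part \<open>a\<close>
  are kept apart so that \<open>a\<close> can collect subgradients of convex summands.\<close>

lemma frechet_subdiffI_smooth_minorant:
  fixes f :: "'a::euclidean_space \<Rightarrow> ereal"
  assumes \<Phi>: "(\<Phi> has_derivative (\<lambda>v. w \<bullet> v)) (at z)" and fz: "f z = ereal r"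
    and minorant: "\<And>y. ereal (r + (\<Phi> y - \<Phi> z) + a \<bullet> (y - z)) \<le> f y"
  shows "w + a \<in> frechet_subdiff f z"
proof -
  \<comment> \<open>\<open>Q\<close> is minus the remainder quotient of \<open>\<Phi>\<close>; it
    tends to 0 and bounds the Frechet quotient from below.\<close>
  define Q where "Q y = - (norm ((\<Phi> y - \<Phi> z) - w \<bullet> (y - z)) / norm (y - z))" for y
  have "(Q \<longlongrightarrow> - 0) (at z)"
    unfolding Q_def using \<Phi> by (intro tendsto_minus) (simp add: has_derivative_iff_norm)
  then have lim: "((\<lambda>y. ereal (Q y)) \<longlongrightarrow> 0) (at z)" by (simp add: zero_ereal_def)
  have le: "ereal (Q y) \<le> (f y - f z - ereal ((w + a) \<bullet> (y - z))) / ereal (norm (y - z))"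
    if "y \<noteq> z" for y
  proof -
    have n: "0 < norm (y - z)" using that by simp
    have "- norm ((\<Phi> y - \<Phi> z) - w \<bullet> (y - z)) \<le> (\<Phi> y - \<Phi> z) - w \<bullet> (y - z)" by simp
    also have "\<dots> = r + (\<Phi> y - \<Phi> z) + a \<bullet> (y - z) - r - (w + a) \<bullet> (y - z)"
      by (simp add: inner_add_left)
    finally have "ereal (- norm ((\<Phi> y - \<Phi> z) - w \<bullet> (y - z)))
        \<le> ereal (r + (\<Phi> y - \<Phi> z) + a \<bullet> (y - z)) - f z - ereal ((w + a) \<bullet> (y - z))"
      by (simp add: fz)
    also have "\<dots> \<le> f y - f z - ereal ((w + a) \<bullet> (y - z))"
      by (intro ereal_minus_mono minorant order_refl)
    finally have "ereal (- norm ((\<Phi> y - \<Phi> z) - w \<bullet> (y - z))) / ereal (norm (y - z))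
        \<le> (f y - f z - ereal ((w + a) \<bullet> (y - z))) / ereal (norm (y - z))"
      by (rule ereal_divide_right_mono) (use n in simp)
    then show ?thesis using n by (simp add: Q_def)
  qed
  have "0 = Liminf (at z) (\<lambda>y. ereal (Q y))"
    using lim_imp_Liminf[OF _ lim] by simp
  also have "\<dots> \<le> Liminf (at z) (\<lambda>y. (f y - f z - ereal ((w + a) \<bullet> (y - z))) / ereal (norm (y - z)))"
    by (intro Liminf_mono) (auto simp: eventually_at_filter le)
  finally show ?thesis by (simp add: frechet_subdiff_def edom_def fz)
qed

lemma frechet_subset_limiting: "frechet_subdiff f x \<subseteq> limiting_subdiff f x"
proof
  fix v assume v: "v \<in> frechet_subdiff f x"
  then have "x \<in> edom f" by (simp add: frechet_subdiff_def)
  moreover have "\<exists>y w. y \<longlonglongrightarrow> x \<and> (\<lambda>k. f (y k)) \<longlonglongrightarrow> f x \<and>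
            (\<forall>k. w k \<in> frechet_subdiff f (y k)) \<and> w \<longlonglongrightarrow> v"
    using v by (intro exI[of _ "\<lambda>_::nat. x"] exI[of _ "\<lambda>_::nat. v"]) auto
  ultimately show "v \<in> limiting_subdiff f x" by (simp add: limiting_subdiff_def)
qed

text \<open>Equality in Fenchel-Young turns the conjugate and coupling terms into
  \<open>\<mu>\<close> times the Bregman distance \<open>D_R(x, u)\<close> with subgradient
  \<open>y\<close>.\<close>

lemma F_surrogate_at_subgradient:
  assumes "y \<in> convex_subdiff (\<lambda>z. ereal (R z)) u"
  shows "F_surrogate (\<lambda>z. ereal (E z)) (\<lambda>z. ereal (R z)) \<beta> \<mu> (x, y)
    = ereal (E x + \<beta> * R x + \<mu> * (R x - R u - y \<bullet> (x - u)))"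
  by (simp add: F_surrogate_def convex_conjugate_at_subgradient[OF assms] algebra_simps inner_commute)

text \<open>\<open>E\<close> and the bilinear coupling form the smooth part. \<open>R\<close> is
  minorized by its affine support of slope \<open>q\<close> at \<open>x\<close>, and the conjugate
  by the affine function of slope \<open>u\<close>, exact at \<open>y\<close> because
  \<open>y\<close> is a subgradient at \<open>u\<close>. The sum touches the surrogate at
  \<open>(x, y)\<close>.\<close>

lemma F_surrogate_frechet_subgradient:
  fixes E R :: "'a::euclidean_space \<Rightarrow> real"
  assumes E: "GDERIV E x :> g" and q: "q \<in> convex_subdiff (\<lambda>z. ereal (R z)) x"
    and y: "y \<in> convex_subdiff (\<lambda>z. ereal (R z)) u" and nn: "0 \<le> \<beta> + \<mu>" "0 \<le> \<mu>"
  shows "(g + (\<beta> + \<mu>) *\<^sub>R q - \<mu> *\<^sub>R y, \<mu> *\<^sub>R (u - x))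
    \<in> frechet_subdiff (F_surrogate (\<lambda>z. ereal (E z)) (\<lambda>z. ereal (R z)) \<beta> \<mu>) (x, y)"
    (is "_ \<in> frechet_subdiff ?F _")
proof -
  define \<Phi> where "\<Phi> = (\<lambda>s :: 'a \<times> 'a. E (fst s) - \<mu> * (fst s \<bullet> snd s))"
  define w where "w = (g - \<mu> *\<^sub>R y, - \<mu> *\<^sub>R x)"
  define a where "a = ((\<beta> + \<mu>) *\<^sub>R q, \<mu> *\<^sub>R u)"
  have "(E has_derivative (\<lambda>v. v \<bullet> g)) (at (fst (x, y)))" using E by (simp add: gderiv_def)
  from has_derivative_compose[OF has_derivative_fst[OF has_derivative_ident] this]
  have "((\<lambda>s. E (fst s)) has_derivative (\<lambda>v. fst v \<bullet> g)) (at (x, y))" by simp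
  then have "(\<Phi> has_derivative (\<lambda>v. fst v \<bullet> g - \<mu> * (x \<bullet> snd v + fst v \<bullet> y))) (at (x, y))"
    unfolding \<Phi>_def by (auto intro!: derivative_eq_intros)
  moreover have "(\<lambda>v. fst v \<bullet> g - \<mu> * (x \<bullet> snd v + fst v \<bullet> y)) = (\<lambda>v. w \<bullet> v)"
    by (simp add: fun_eq_iff w_def inner_prod_def algebra_simps inner_diff_left) (simp add: inner_commute)
  ultimately have d: "(\<Phi> has_derivative (\<lambda>v. w \<bullet> v)) (at (x, y))" by simp
  have v: "?F (x, y) = ereal (E x + \<beta> * R x + \<mu> * (R x - R u - y \<bullet> (x - u)))"
    by (rule F_surrogate_at_subgradient[OF y])
  have "w + a \<in> frechet_subdiff ?F (x, y)"
  proof (rule frechet_subdiffI_smooth_minorant[of \<Phi> w "(x, y)" ?F _ a, OF d v], clarify)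
    fix x' y'
    have "(\<beta> + \<mu>) * (R x + q \<bullet> (x' - x)) \<le> (\<beta> + \<mu>) * R x'"
      using q nn by (intro mult_left_mono) (auto simp: mem_convex_subdiff_real)
    then have "ereal (E x + \<beta> * R x + \<mu> * (R x - R u - y \<bullet> (x - u)) + (\<Phi> (x', y') - \<Phi> (x, y)) + a \<bullet> ((x', y') - (x, y)))
      \<le> ereal (E x') + ereal (\<beta> + \<mu>) * ereal (R x') + ereal \<mu> * ereal (u \<bullet> y' - R u) - ereal (\<mu> * (x' \<bullet> y'))"
      by (simp add: \<Phi>_def a_def inner_prod_def algebra_simps) (simp add: inner_commute)
    also have "\<dots> \<le> ?F (x', y')"
      unfolding F_surrogate_def prod.case
      by (intro ereal_minus_mono add_mono ereal_mult_left_mono convex_conjugate_ge order_refl) (use nn in simp)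
    finally show "ereal (E x + \<beta> * R x + \<mu> * (R x - R u - y \<bullet> (x - u)) + (\<Phi> (x', y') - \<Phi> (x, y)) + a \<bullet> ((x', y') - (x, y)))
      \<le> ?F (x', y')" .
  qed
  moreover have "w + a = (g + (\<beta> + \<mu>) *\<^sub>R q - \<mu> *\<^sub>R y, \<mu> *\<^sub>R (u - x))"
    by (simp add: w_def a_def algebra_simps)
  ultimately show ?thesis by simp
qed

text \<open>In the application \<open>u \<bullet> q - R u\<close> and
  \<open>u' \<bullet> q' - R u'\<close> are values of the conjugate. Its affine minorant of slope
  \<open>u\<close> replaces a gradient, so the quotient in the limit passage is the constant
  \<open>u \<bullet> (q' - q)\<close>.\<close>

lemma conjugate_strong_monotone:
  fixes R :: "'a::real_inner \<Rightarrow> real"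
  assumes strong: "\<And>t. 0 < t \<Longrightarrow> t < 1 \<Longrightarrow>
      convex_conjugate (\<lambda>z. ereal (R z)) ((1 - t) *\<^sub>R q + t *\<^sub>R q')
        \<le> ereal ((1 - t) * (u \<bullet> q - R u) + t * (u' \<bullet> q' - R u') - c / 2 * t * (1 - t) * (norm (q - q'))\<^sup>2)"
  shows "(u \<bullet> q - R u) + u \<bullet> (q' - q) + c / 2 * (norm (q' - q))\<^sup>2 \<le> u' \<bullet> q' - R u'"
proof -
  have "u \<bullet> (q' - q) \<le> ((u' \<bullet> q' - R u') - (u \<bullet> q - R u)) - c / 2 * (norm (q - q'))\<^sup>2"
  proof (rule tendsto_at_right_segment_le[OF tendsto_const])
    fix t :: real assume t: "0 < t" "t < 1"
    have "u \<bullet> ((1 - t) *\<^sub>R q + t *\<^sub>R q') - R u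
      \<le> (1 - t) * (u \<bullet> q - R u) + t * (u' \<bullet> q' - R u') - c / 2 * t * (1 - t) * (norm (q - q'))\<^sup>2"
      using order_trans[OF convex_conjugate_ge strong[OF t]] by simp
    then have "t * (u \<bullet> (q' - q))
      \<le> t * (((u' \<bullet> q' - R u') - (u \<bullet> q - R u)) - (1 - t) * (c / 2 * (norm (q - q'))\<^sup>2))"
      by (simp add: algebra_simps inner_add_right inner_diff_right)
    then show "u \<bullet> (q' - q) \<le> ((u' \<bullet> q' - R u') - (u \<bullet> q - R u)) - (1 - t) * (c / 2 * (norm (q - q'))\<^sup>2)"
      using t(1) by (simp only: mult_le_cancel_left_pos)
  qed
  then show ?thesis by (simp add: norm_minus_commute)
qed


lemma convergent_of_finite_length:
  fixes u :: "nat \<Rightarrow> 'a::banach"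
  assumes "summable (\<lambda>k. norm (u (Suc k) - u k))"
  shows "convergent u"
proof -
  have "summable (\<lambda>k. u (Suc k) - u k)" using assms by (rule summable_norm_cancel)
  then have "convergent (\<lambda>n. \<Sum>k<n. u (Suc k) - u k)" by (simp add: summable_iff_convergent)
  then have "convergent (\<lambda>n. u n - u 0)" by (simp add: sum_lessThan_telescope)
  then obtain a where "(\<lambda>n. u n - u 0) \<longlonglongrightarrow> a" by (auto simp: convergent_def)
  from tendsto_add[OF this tendsto_const[of "u 0"]] show ?thesis by (intro convergentI) simp
qed

text \<open>Serves to put the convex hull of the \<open>p k\<close> inside the domain of the
  conjugate, where strong convexity applies.\<close>

lemma convex_edom_conjugate: "convex (edom (convex_conjugate (\<lambda>z. ereal (R z))))"
  unfolding convex_def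
proof (intro ballI allI impI)
  fix q q' and a b :: real
  assume q: "q \<in> edom (convex_conjugate (\<lambda>z. ereal (R z)))" "q' \<in> edom (convex_conjugate (\<lambda>z. ereal (R z)))"
    and ab: "0 \<le> a" "0 \<le> b" "a + b = 1"
  have ub: "\<exists>C. \<forall>u. u \<bullet> s - R u \<le> C" if s: "s \<in> edom (convex_conjugate (\<lambda>z. ereal (R z)))" for s
  proof -
    obtain C where "convex_conjugate (\<lambda>z. ereal (R z)) s \<le> ereal C"
      using s by (cases "convex_conjugate (\<lambda>z. ereal (R z)) s") (auto simp: edom_def)
    then show ?thesis using order_trans[OF convex_conjugate_ge, of R s "ereal C"] by auto
  qed
  obtain C C' where C: "\<And>u. u \<bullet> q - R u \<le> C" "\<And>u. u \<bullet> q' - R u \<le> C'" using ub q by metis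
  have "u \<bullet> (a *\<^sub>R q + b *\<^sub>R q') - R u \<le> a * C + b * C'" for u
  proof -
    have "u \<bullet> (a *\<^sub>R q + b *\<^sub>R q') - R u = a * (u \<bullet> q - R u) + b * (u \<bullet> q' - R u) - (1 - (a + b)) * R u"
      by (simp add: algebra_simps inner_add_right)
    also have "\<dots> \<le> a * C + b * C'" using ab C by (auto intro!: add_mono mult_left_mono)
    finally show ?thesis .
  qed
  then have "convex_conjugate (\<lambda>z. ereal (R z)) (a *\<^sub>R q + b *\<^sub>R q') \<le> ereal (a * C + b * C')"
    unfolding convex_conjugate_def by (intro SUP_least) simp
  then show "a *\<^sub>R q + b *\<^sub>R q' \<in> edom (convex_conjugate (\<lambda>z. ereal (R z)))"
    by (auto simp: edom_def intro: le_less_trans)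
qed

subsection \<open>The iteration\<close>

text \<open>The analytic core, with real-valued data on the whole space. Hypotheses take the form in
  which they are used: strong convexity as a quadratic tangent bound, the symmetry coefficient with
  its quotient cleared, convexity of \<open>L h - E\<close> as a descent inequality, the update of
  \<open>p\<close> multiplied by \<open>\<mu> k + \<beta>\<close>.\<close>

locale bregman_iteration =
  fixes H R E :: "'a::euclidean_space \<Rightarrow> real" and gH gE :: "'a \<Rightarrow> 'a"
    and c L \<beta> \<alpha> \<mu>' \<omega> \<tau> m :: real and \<delta> \<mu> :: "nat \<Rightarrow> real" and x p :: "nat \<Rightarrow> 'a"
  assumes c_pos: "0 < c"
    and H_strong: "\<And>y z. H y + gH y \<bullet> (z - y) + c / 2 * (norm (z - y))\<^sup>2 \<le> H z"
    and H_sym: "\<And>y z. \<alpha> * (H z - H y - gH y \<bullet> (z - y)) \<le> H y - H z - gH z \<bullet> (y - z)"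
    and E_grad: "\<And>y. GDERIV E y :> gE y"
    and E_descent: "\<And>y z. E z \<le> E y + gE y \<bullet> (z - y) + L * (H z - H y - gH y \<bullet> (z - y))"
    and gH_lip: "\<And>U. bounded U \<Longrightarrow> \<exists>l>0. \<forall>y\<in>U. \<forall>z\<in>U. norm (gH y - gH z) \<le> l * norm (y - z)"
    and gE_lip: "\<And>U. bounded U \<Longrightarrow> \<exists>l>0. \<forall>y\<in>U. \<forall>z\<in>U. norm (gE y - gE z) \<le> l * norm (y - z)"
    and R_convex: "convex_on UNIV R"
    and R_sub_bdd: "\<And>U. bounded U \<Longrightarrow>
          \<exists>C>0. \<forall>z\<in>U. \<forall>q\<in>convex_subdiff (\<lambda>z. ereal (R z)) z. norm q \<le> C"
    and f_below: "\<And>z. m \<le> E z + \<beta> * R z"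
    and level_bdd: "bounded {z. E z + \<beta> * R z \<le> E (x 0) + \<beta> * R (x 0)}"
    and L_pos: "0 < L" and \<beta>_nonneg: "0 \<le> \<beta>" and \<mu>'_pos: "0 < \<mu>'" and \<omega>_pos: "0 < \<omega>"
    and \<delta>_pos: "\<And>k. 0 < \<delta> k" and \<delta>_lt: "\<And>k. \<delta> k < (1 + \<alpha> - \<omega>) / L"
    and \<tau>_pos: "0 < \<tau>" and \<tau>_lt: "\<And>k. \<tau> < \<delta> k * \<mu> k"
    and \<mu>_ge: "\<And>k. \<mu>' \<le> \<mu> k" and \<mu>_sum: "summable (\<lambda>k. \<mu> k - \<mu>')"
    and KL: "\<And>s. limiting_subdiff (F_surrogate (\<lambda>z. ereal (E z)) (\<lambda>z. ereal (R z)) \<beta> \<mu>') s \<noteq> {}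
          \<Longrightarrow> KL_at (F_surrogate (\<lambda>z. ereal (E z)) (\<lambda>z. ereal (R z)) \<beta> \<mu>') s"
    and subgrad: "\<And>k. p k \<in> convex_subdiff (\<lambda>z. ereal (R z)) (x k)"
    and step: "\<And>k. (\<mu> k + \<beta>) *\<^sub>R p (Suc k)
          = \<mu> k *\<^sub>R p k - (1 / \<delta> k) *\<^sub>R (gH (x (Suc k)) - gH (x k)) - gE (x k)"
begin

abbreviation "f z \<equiv> E z + \<beta> * R z"

abbreviation "F \<equiv> F_surrogate (\<lambda>z. ereal (E z)) (\<lambda>z. ereal (R z)) \<beta> \<mu>'"

definition "D k = R (x (Suc k)) - R (x k) - p k \<bullet> (x (Suc k) - x k)"

text \<open>A lower bound, uniform in \<open>k\<close>, for the surplus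
  \<open>(1 + \<alpha>) / \<delta> k - L\<close>, times the factor \<open>c / 2\<close> from strong
  convexity.\<close>

definition "c' = \<omega> * L / (1 + \<alpha> - \<omega>) * (c / 2)"

section \<open>Sufficient decrease and boundedness of the iterates\<close>

lemma subgrad_le: "R (x k) + p k \<bullet> (z - x k) \<le> R z"
  using subgrad by (simp add: mem_convex_subdiff_real)

lemma \<mu>_pos: "0 < \<mu> k"
  using \<mu>_ge[of k] \<mu>'_pos by simp

lemma D_nonneg: "0 \<le> D k"
  using subgrad_le[of k "x (Suc k)"] by (simp add: D_def)

lemma \<alpha>_gt: "0 < 1 + \<alpha> - \<omega>"
  using \<delta>_pos[of 0] \<delta>_lt[of 0] L_pos by (metis less_trans zero_less_divide_iff not_less_iff_gr_or_eq)

lemma c'_pos: "0 < c'"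
  using \<alpha>_gt \<omega>_pos L_pos c_pos by (simp add: c'_def)

text \<open>Tested against the step, the \<open>H\<close> terms give the symmetrized Bregman
  distance, at least \<open>(1 + \<alpha>) * DH\<close>. After division by
  \<open>\<delta> k\<close>, a part \<open>L * DH\<close> pays for the nonconvexity of
  \<open>E\<close>, and the step-size bound leaves a positive multiple of \<open>DH\<close>.\<close>

lemma descent: "f (x (Suc k)) + \<mu>' * D k + c' * (norm (x (Suc k) - x k))\<^sup>2 \<le> f (x k)"
proof -
  define v where "v = x (Suc k) - x k"
  define DH where "DH = H (x (Suc k)) - H (x k) - gH (x k) \<bullet> v"
  have DH: "c / 2 * (norm v)\<^sup>2 \<le> DH"
    using H_strong[of "x k" "x (Suc k)"] by (simp add: DH_def v_def)
  then have DH0: "0 \<le> DH" using c_pos by (meson divide_nonneg_nonneg less_imp_le mult_nonneg_nonneg order_trans zero_le_numeral zero_le_power2)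
  have s: "((\<mu> k + \<beta>) *\<^sub>R p (Suc k)) \<bullet> v
      = (\<mu> k *\<^sub>R p k - (1 / \<delta> k) *\<^sub>R (gH (x (Suc k)) - gH (x k)) - gE (x k)) \<bullet> v"
    by (simp only: step)
  then have s: "\<beta> * (p (Suc k) \<bullet> v) + \<mu> k * (p (Suc k) \<bullet> v - p k \<bullet> v)
      + (1 / \<delta> k) * ((gH (x (Suc k)) - gH (x k)) \<bullet> v) + gE (x k) \<bullet> v = 0"
    by (simp add: inner_diff_left algebra_simps)
  have p: "R (x (Suc k)) - R (x k) \<le> p (Suc k) \<bullet> v"
    using subgrad_le[of "Suc k" "x k"] by (simp add: v_def inner_diff_right)
  have 1: "\<beta> * (R (x (Suc k)) - R (x k)) \<le> \<beta> * (p (Suc k) \<bullet> v)"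
    using p \<beta>_nonneg by (rule mult_left_mono)
  have "D k \<le> p (Suc k) \<bullet> v - p k \<bullet> v" using p by (simp add: D_def v_def)
  \<comment> \<open>\<open>\<mu> k\<close> may be lowered to \<open>\<mu>'\<close> because the
    factor it multiplies is at least \<open>D k\<close>, hence nonnegative.\<close>
  then have 2: "\<mu>' * D k \<le> \<mu> k * (p (Suc k) \<bullet> v - p k \<bullet> v)"
    using \<mu>_ge[of k] \<mu>'_pos D_nonneg[of k] by (intro mult_mono) auto
  have "(1 + \<alpha>) * DH \<le> (gH (x (Suc k)) - gH (x k)) \<bullet> v"
    using H_sym[of "x (Suc k)" "x k"]
    by (simp add: DH_def v_def algebra_simps inner_diff_left inner_diff_right)
  then have 3: "(1 / \<delta> k) * ((1 + \<alpha>) * DH) \<le> (1 / \<delta> k) * ((gH (x (Suc k)) - gH (x k)) \<bullet> v)"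
    using \<delta>_pos[of k] by (intro mult_left_mono) auto
  have 4: "E (x (Suc k)) - E (x k) - L * DH \<le> gE (x k) \<bullet> v"
    using E_descent[of "x (Suc k)" "x k"] by (simp add: DH_def v_def)
  have dl: "\<delta> k * L < 1 + \<alpha> - \<omega>" using \<delta>_lt[of k] L_pos by (simp add: pos_less_divide_eq)
  have "\<omega> * L / (1 + \<alpha> - \<omega>) \<le> \<omega> / \<delta> k"
  proof -
    have "\<omega> * (\<delta> k * L) \<le> \<omega> * (1 + \<alpha> - \<omega>)" using dl \<omega>_pos by (intro mult_left_mono) auto
    moreover have "\<omega> * L / K \<le> \<omega> / \<delta> k" if "0 < K" "\<omega> * (\<delta> k * L) \<le> \<omega> * K" for K
      using that \<delta>_pos[of k] by (simp add: field_simps)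
    ultimately show ?thesis using \<alpha>_gt by blast
  qed
  also have "\<dots> \<le> (1 / \<delta> k) * (1 + \<alpha>) - L"
    using dl \<delta>_pos[of k] by (simp add: field_simps)
  finally have rate: "\<omega> * L / (1 + \<alpha> - \<omega>) \<le> (1 / \<delta> k) * (1 + \<alpha>) - L" .
  have "0 \<le> \<omega> * L / (1 + \<alpha> - \<omega>)" using \<alpha>_gt \<omega>_pos L_pos by simp
  then have "\<omega> * L / (1 + \<alpha> - \<omega>) * (c / 2 * (norm v)\<^sup>2) \<le> ((1 / \<delta> k) * (1 + \<alpha>) - L) * DH"
    using DH c_pos by (intro mult_mono rate order_trans[OF _ rate]) auto
  then have 5: "c' * (norm v)\<^sup>2 \<le> (1 / \<delta> k) * ((1 + \<alpha>) * DH) - L * DH"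
    by (simp add: c'_def left_diff_distrib mult.assoc)
  show ?thesis using s 1 2 3 4 5 unfolding v_def[symmetric] right_diff_distrib by linarith
qed

lemma f_decseq: "decseq (\<lambda>k. f (x k))"
  unfolding decseq_Suc_iff
proof
  fix k
  have "0 \<le> \<mu>' * D k" "0 \<le> c' * (norm (x (Suc k) - x k))\<^sup>2"
    using D_nonneg[of k] \<mu>'_pos c'_pos by auto
  then show "f (x (Suc k)) \<le> f (x k)" using descent[of k] by linarith
qed

lemma x_bdd: "bounded (range x)"
  by (rule bounded_subset[OF level_bdd]) (use decseqD[OF f_decseq] in auto)

lemma p_bdd: "bounded (range p)"
proof -
  obtain C where "\<forall>z\<in>range x. \<forall>q\<in>convex_subdiff (\<lambda>z. ereal (R z)) z. norm q \<le> C"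
    using R_sub_bdd[OF x_bdd] by blast
  then show ?thesis using subgrad by (auto simp: bounded_iff)
qed

definition "v = lim (\<lambda>k. f (x k))"

lemma f_tendsto: "(\<lambda>k. f (x k)) \<longlonglongrightarrow> v"
proof -
  have "convergent (\<lambda>k. f (x k))"
    by (rule decseq_convergent[OF f_decseq, of m]) (use f_below in \<open>auto intro: convergentI\<close>)
  then show ?thesis by (simp add: v_def convergent_LIMSEQ_iff)
qed

text \<open>Squared steps are bounded by differences of a convergent sequence. This weaker fact is
  needed before finite length, so that \<open>x k\<close> and \<open>x (Suc k)\<close> share their
  cluster points.\<close>

lemma x_step_tendsto: "(\<lambda>k. x (Suc k) - x k) \<longlonglongrightarrow> 0"
proof -
  have "(\<lambda>k. (f (x k) - f (x (Suc k))) / c') \<longlonglongrightarrow> (v - v) / c'"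
    using c'_pos by (intro tendsto_divide[OF tendsto_diff[OF f_tendsto LIMSEQ_Suc[OF f_tendsto]] tendsto_const]) simp
  then have lim: "(\<lambda>k. (f (x k) - f (x (Suc k))) / c') \<longlonglongrightarrow> 0" by simp
  have le: "(norm (x (Suc k) - x k))\<^sup>2 \<le> (f (x k) - f (x (Suc k))) / c'" for k
  proof -
    have "0 \<le> \<mu>' * D k" using D_nonneg[of k] \<mu>'_pos by auto
    then show ?thesis using descent[of k] c'_pos by (simp add: field_simps)
  qed
  have "(\<lambda>k. (norm (x (Suc k) - x k))\<^sup>2) \<longlonglongrightarrow> 0"
    by (rule tendsto_sandwich[OF _ _ tendsto_const lim]) (simp_all add: le)
  then have "(\<lambda>k. norm (x (Suc k) - x k)) \<longlonglongrightarrow> 0"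
    by (simp add: tendsto_null_power)
  then show ?thesis by (rule tendsto_norm_zero_cancel)
qed

text \<open>The dual variable lags one step behind: only then are both components of the subgradient
  \<open>w k\<close> controlled by the step of \<open>x\<close>.\<close>

definition "z k = (x (Suc k), p k)"

definition "w k = (gE (x (Suc k)) + (\<beta> + \<mu>') *\<^sub>R p (Suc k) - \<mu>' *\<^sub>R p k, \<mu>' *\<^sub>R (x k - x (Suc k)))"

section \<open>Surrogate values and subgradients along the trajectory\<close>

lemma F_z: "F (z k) = ereal (f (x (Suc k)) + \<mu>' * D k)"
  unfolding z_def D_def by (rule F_surrogate_at_subgradient[OF subgrad])

lemma w_frechet: "w k \<in> frechet_subdiff F (z k)"
  unfolding z_def w_def
  using \<beta>_nonneg \<mu>'_pos by (intro F_surrogate_frechet_subgradient E_grad subgrad) auto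

lemma F_tendsto: "(\<lambda>k. f (x (Suc k)) + \<mu>' * D k) \<longlonglongrightarrow> v"
proof (rule tendsto_sandwich[OF _ _ LIMSEQ_Suc[OF f_tendsto] f_tendsto])
  show "\<forall>\<^sub>F k in sequentially. f (x (Suc k)) \<le> f (x (Suc k)) + \<mu>' * D k"
    using D_nonneg \<mu>'_pos by simp
  show "\<forall>\<^sub>F k in sequentially. f (x (Suc k)) + \<mu>' * D k \<le> f (x k)"
  proof (rule always_eventually, rule allI)
    fix k
    have "0 \<le> c' * (norm (x (Suc k) - x k))\<^sup>2" using c'_pos by simp
    then show "f (x (Suc k)) + \<mu>' * D k \<le> f (x k)" using descent[of k] by linarith
  qed
qed

lemma F_decrease: "f (x (Suc (Suc k))) + \<mu>' * D (Suc k) + c' * (norm (x (Suc (Suc k)) - x (Suc k)))\<^sup>2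
    \<le> f (x (Suc k)) + \<mu>' * D k"
proof -
  have "0 \<le> \<mu>' * D k" using D_nonneg[of k] \<mu>'_pos by simp
  then show ?thesis using descent[of "Suc k"] by linarith
qed

text \<open>The reciprocal step sizes are bounded: \<open>\<delta> k * \<mu> k\<close> stays above
  \<open>\<tau>\<close>, and \<open>\<mu>\<close> is bounded because its excess over
  \<open>\<mu>'\<close> is summable.\<close>

lemma gH_step_bound:
  obtains K where "0 < K"
    "\<And>k. norm ((1 / \<delta> k) *\<^sub>R (gH (x (Suc k)) - gH (x k))) \<le> K * norm (x (Suc k) - x k)"
proof -
  obtain l where l: "l > 0" "\<And>i j. norm (gH (x i) - gH (x j)) \<le> l * norm (x i - x j)"
    using gH_lip[OF x_bdd] by auto
  have "(\<lambda>k. \<mu> k - \<mu>') \<longlonglongrightarrow> 0" by (rule summable_LIMSEQ_zero[OF \<mu>_sum])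
  then have "bounded (range (\<lambda>k. \<mu> k - \<mu>'))" by (rule convergent_imp_bounded)
  then obtain M0 where M0: "\<And>k. \<bar>\<mu> k - \<mu>'\<bar> \<le> M0" by (auto simp: bounded_iff)
  define M where "M = M0 + \<mu>'"
  have M: "\<mu> k \<le> M" for k using M0[of k] by (simp add: M_def)
  have "M > 0" using M[of 0] \<mu>_pos[of 0] by simp
  have inv: "1 / \<delta> k \<le> M / \<tau>" for k
  proof -
    have "\<tau> \<le> \<delta> k * M"
      using \<tau>_lt[of k] mult_left_mono[OF M[of k], of "\<delta> k"] \<delta>_pos[of k] by linarith
    then show ?thesis using \<delta>_pos[of k] \<tau>_pos by (simp add: field_simps)
  qed
  show ?thesis
  proof (rule that[of "M / \<tau> * l"])
    show "0 < M / \<tau> * l" using \<open>M > 0\<close> \<tau>_pos l by simp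
    fix k
    have "norm ((1 / \<delta> k) *\<^sub>R (gH (x (Suc k)) - gH (x k))) = 1 / \<delta> k * norm (gH (x (Suc k)) - gH (x k))"
      using \<delta>_pos[of k] by simp
    also have "\<dots> \<le> M / \<tau> * (l * norm (x (Suc k) - x k))"
      using inv l \<open>M > 0\<close> \<tau>_pos by (intro mult_mono) auto
    finally show "norm ((1 / \<delta> k) *\<^sub>R (gH (x (Suc k)) - gH (x k))) \<le> M / \<tau> * l * norm (x (Suc k) - x k)"
      by (simp add: mult.assoc)
  qed
qed

lemma w_bound:
  obtains b C where "0 < b" "0 < C" "\<And>k. norm (w k) \<le> b * norm (x (Suc k) - x k) + C * (\<mu> k - \<mu>')"
proof -
  obtain lE where lE: "lE > 0" "\<And>i j. norm (gE (x i) - gE (x j)) \<le> lE * norm (x i - x j)"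
    using gE_lip[OF x_bdd] by auto
  obtain B where B: "B > 0" "\<And>k. norm (p k) \<le> B" using p_bdd by (auto simp: bounded_pos)
  obtain K where K: "0 < K"
    "\<And>k. norm ((1 / \<delta> k) *\<^sub>R (gH (x (Suc k)) - gH (x k))) \<le> K * norm (x (Suc k) - x k)"
    by (rule gH_step_bound) blast
  have "norm (w k) \<le> (lE + K + \<mu>') * norm (x (Suc k) - x k) + 2 * B * (\<mu> k - \<mu>')" for k
  proof -
    let ?n = "norm (x (Suc k) - x k)"
    \<comment> \<open>Substituting the update formula cancels the dual terms except for the
      increment of \<open>p\<close> with coefficient \<open>\<mu> k - \<mu>'\<close>, where
      boundedness of \<open>p\<close> suffices.\<close>
    have "gE (x (Suc k)) + (\<beta> + \<mu>') *\<^sub>R p (Suc k) - \<mu>' *\<^sub>R p k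
      = (gE (x (Suc k)) - gE (x k)) - (1 / \<delta> k) *\<^sub>R (gH (x (Suc k)) - gH (x k))
        - (\<mu> k - \<mu>') *\<^sub>R (p (Suc k) - p k)"
      using step[of k] by (simp add: algebra_simps)
    also have "norm \<dots> \<le> norm (gE (x (Suc k)) - gE (x k))
        + norm ((1 / \<delta> k) *\<^sub>R (gH (x (Suc k)) - gH (x k))) + norm ((\<mu> k - \<mu>') *\<^sub>R (p (Suc k) - p k))"
      by (rule order_trans[OF norm_triangle_ineq4]) (intro add_right_mono norm_triangle_ineq4)
    also have "\<dots> \<le> lE * ?n + K * ?n + (\<mu> k - \<mu>') * (B + B)"
    proof (intro add_mono lE K)
      have "norm (p (Suc k) - p k) \<le> B + B"
        by (rule order_trans[OF norm_triangle_ineq4]) (intro add_mono B)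
      then show "norm ((\<mu> k - \<mu>') *\<^sub>R (p (Suc k) - p k)) \<le> (\<mu> k - \<mu>') * (B + B)"
        using \<mu>_ge[of k] by (simp add: mult_left_mono)
    qed
    finally have 1: "norm (gE (x (Suc k)) + (\<beta> + \<mu>') *\<^sub>R p (Suc k) - \<mu>' *\<^sub>R p k)
      \<le> lE * ?n + K * ?n + (\<mu> k - \<mu>') * (B + B)" .
    have 2: "norm (\<mu>' *\<^sub>R (x k - x (Suc k))) = \<mu>' * ?n" using \<mu>'_pos by (simp add: norm_minus_commute)
    have "norm (w k) \<le> norm (gE (x (Suc k)) + (\<beta> + \<mu>') *\<^sub>R p (Suc k) - \<mu>' *\<^sub>R p k) + norm (\<mu>' *\<^sub>R (x k - x (Suc k)))"
      unfolding w_def by (rule norm_Pair_le)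
    then show ?thesis using 1 2 by (simp add: algebra_simps)
  qed
  then show ?thesis using lE(1) K(1) \<mu>'_pos B(1) by (intro that[of "lE + K + \<mu>'" "2 * B"]) auto
qed

lemma w_tendsto: "w \<longlonglongrightarrow> 0"
proof -
  obtain b C where bC: "\<And>k. norm (w k) \<le> b * norm (x (Suc k) - x k) + C * (\<mu> k - \<mu>')"
    by (rule w_bound) blast
  have "(\<lambda>k. b * norm (x (Suc k) - x k) + C * (\<mu> k - \<mu>')) \<longlonglongrightarrow> b * norm (0::'a) + C * 0"
    by (intro tendsto_intros x_step_tendsto summable_LIMSEQ_zero[OF \<mu>_sum])
  then have "(\<lambda>k. b * norm (x (Suc k) - x k) + C * (\<mu> k - \<mu>')) \<longlonglongrightarrow> 0" by simp
  then have "(\<lambda>k. norm (w k)) \<longlonglongrightarrow> 0"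
    by (rule tendsto_sandwich[OF _ _ tendsto_const, rotated 2]) (use bC in auto)
  then show ?thesis by (rule tendsto_norm_zero_cancel)
qed

lemma R_tendsto: "u \<longlonglongrightarrow> a \<Longrightarrow> (\<lambda>n. R (u n)) \<longlonglongrightarrow> R a"
  using convex_on_continuous[OF open_UNIV R_convex] continuous_on_tendsto_compose[of UNIV R u a] by auto

lemma E_tendsto: "u \<longlonglongrightarrow> a \<Longrightarrow> (\<lambda>n. E (u n)) \<longlonglongrightarrow> E a"
  using E_grad[of a] unfolding gderiv_def
  by (auto intro: isCont_tendsto_compose[of a E] has_derivative_continuous)

lemma subgrad_closed:
  assumes "u \<longlonglongrightarrow> a" "q \<longlonglongrightarrow> b" "\<And>n. q n \<in> convex_subdiff (\<lambda>z. ereal (R z)) (u n)"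
  shows "b \<in> convex_subdiff (\<lambda>z. ereal (R z)) a"
  unfolding mem_convex_subdiff_real
proof
  fix y
  have "(\<lambda>n. R (u n) + q n \<bullet> (y - u n)) \<longlonglongrightarrow> R a + b \<bullet> (y - a)"
    by (intro tendsto_intros R_tendsto assms)
  then show "R a + b \<bullet> (y - a) \<le> R y"
    by (rule tendsto_upperbound) (use assms(3) in \<open>auto simp: mem_convex_subdiff_real\<close>)
qed

text \<open>Vanishing steps give \<open>x (r n)\<close> the same limit as
  \<open>x (Suc (r n))\<close>, so the lagged \<open>p (r n)\<close> tends to a subgradient of
  \<open>R\<close> at that limit.\<close>

lemma cluster_point:
  assumes r: "filterlim r at_top sequentially" and l: "(\<lambda>n. z (r n)) \<longlonglongrightarrow> l"
  shows "F l = ereal v \<and> KL_at F l"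
proof -
  obtain a b where ab: "l = (a, b)" by force
  have a: "(\<lambda>n. x (Suc (r n))) \<longlonglongrightarrow> a" and b: "(\<lambda>n. p (r n)) \<longlonglongrightarrow> b"
    using tendsto_fst[OF l] tendsto_snd[OF l] by (simp_all add: ab z_def)
  have "(\<lambda>n. x (Suc (r n)) - (x (Suc (r n)) - x (r n))) \<longlonglongrightarrow> a - 0"
    by (intro tendsto_diff a filterlim_compose[OF x_step_tendsto r])
  then have a': "(\<lambda>n. x (r n)) \<longlonglongrightarrow> a" by simp
  have "(\<lambda>n. f (x (r n))) \<longlonglongrightarrow> f a" by (intro tendsto_intros R_tendsto E_tendsto a')
  moreover have "(\<lambda>n. f (x (r n))) \<longlonglongrightarrow> v" by (rule filterlim_compose[OF f_tendsto r])
  ultimately have fa: "f a = v" by (rule LIMSEQ_unique)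
  have "b \<in> convex_subdiff (\<lambda>z. ereal (R z)) a" by (rule subgrad_closed[OF a' b subgrad])
  \<comment> \<open>Both points of the Bregman term are now \<open>a\<close>, so it vanishes and the
    surrogate reduces to \<open>f a\<close>.\<close>
  from F_surrogate_at_subgradient[OF this]
  have Fl: "F l = ereal v" by (simp add: ab flip: fa)
  have "(\<lambda>n. F (z (r n))) \<longlonglongrightarrow> F l"
    unfolding Fl F_z by (intro tendsto_intros filterlim_compose[OF F_tendsto r])
  moreover have "(\<lambda>n. w (r n)) \<longlonglongrightarrow> 0" by (rule filterlim_compose[OF w_tendsto r])
  \<comment> \<open>Criticality of \<open>l\<close> supplies the nonempty subdifferential that the
    KL hypothesis asks for.\<close>
  ultimately have "0 \<in> limiting_subdiff F l"
    using l w_frechet unfolding limiting_subdiff_def mem_Collect_eq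
    by (intro conjI exI[of _ "\<lambda>n. z (r n)"] exI[of _ "\<lambda>n. w (r n)"]) (auto simp: edom_def Fl)
  then show ?thesis using Fl KL by blast
qed

lemma finite_length: "summable (\<lambda>k. norm (x (Suc k) - x k))"
proof -
  obtain b C where bC: "0 < b" "0 < C" "\<And>k. norm (w k) \<le> b * norm (x (Suc k) - x k) + C * (\<mu> k - \<mu>')"
    by (rule w_bound) blast
  have "range z \<subseteq> range x \<times> range p" by (auto simp: z_def)
  then have bdd: "bounded (range z)" using bounded_Times[OF x_bdd p_bdd] by (rule bounded_subset[rotated])
  \<comment> \<open>In the abstract lemma index \<open>k\<close> stands for the step from
    \<open>x (Suc k)\<close>, which \<open>F_decrease\<close> pays for and which bounds
    \<open>w (Suc k)\<close>; hence the shifted error.\<close>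
  have e: "summable (\<lambda>k. C * (\<mu> (Suc k) - \<mu>'))"
    using \<mu>_sum summable_Suc_iff[of "\<lambda>k. \<mu> k - \<mu>'"] by (intro summable_mult) simp
  have "summable (\<lambda>k. norm (x (Suc (Suc k)) - x (Suc k)))"
    by (intro KL_finite_length[OF bdd _ F_z F_tendsto _ c'_pos F_decrease bC(1) bC(3) _ e]
        cluster_point subsetD[OF frechet_subset_limiting] w_frechet norm_ge_zero)
  then show ?thesis by (subst (asm) summable_Suc_iff[of "\<lambda>k. norm (x (Suc k) - x k)"])
qed

section \<open>Limits of the primal and dual sequences\<close>

lemma x_convergent: obtains xs where "x \<longlonglongrightarrow> xs"
  using convergent_of_finite_length[OF finite_length] by (auto simp: convergent_def)

lemma gE_tendsto:
  assumes "u \<longlonglongrightarrow> a"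
  shows "(\<lambda>n. gE (u n)) \<longlonglongrightarrow> gE a"
proof -
  \<comment> \<open>Adding the limit to the bounded set makes one Lipschitz constant cover all pairs
    of \<open>u n\<close> and \<open>a\<close>.\<close>
  have "bounded (insert a (range u))" using convergent_imp_bounded[OF assms] by simp
  from gE_lip[OF this] obtain l where l: "\<And>n. norm (gE (u n) - gE a) \<le> l * norm (u n - a)" by auto
  have "(\<lambda>n. l * norm (u n - a)) \<longlonglongrightarrow> l * norm (a - a)" by (intro tendsto_intros assms)
  then have "(\<lambda>n. l * norm (u n - a)) \<longlonglongrightarrow> 0" by simp
  then have "(\<lambda>n. gE (u n) - gE a) \<longlonglongrightarrow> 0"
    by (rule Lim_null_comparison[rotated]) (simp add: l)
  then show ?thesis by (rule LIM_zero_cancel)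
qed

lemma \<mu>_tendsto: "\<mu> \<longlonglongrightarrow> \<mu>'"
  using summable_LIMSEQ_zero[OF \<mu>_sum] by (rule LIM_zero_cancel)

text \<open>The limit of the update formula: its \<open>H\<close> term is bounded by a multiple of
  the step and vanishes.\<close>

lemma step_tendsto:
  assumes "x \<longlonglongrightarrow> xs"
  shows "(\<lambda>k. (\<mu> k + \<beta>) *\<^sub>R p (Suc k) - \<mu> k *\<^sub>R p k) \<longlonglongrightarrow> - gE xs"
proof -
  obtain K where K: "\<And>k. norm ((1 / \<delta> k) *\<^sub>R (gH (x (Suc k)) - gH (x k))) \<le> K * norm (x (Suc k) - x k)"
    by (rule gH_step_bound) blast
  have "(\<lambda>k. K * norm (x (Suc k) - x k)) \<longlonglongrightarrow> K * norm (0::'a)"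
    by (intro tendsto_intros x_step_tendsto)
  then have lim: "(\<lambda>k. K * norm (x (Suc k) - x k)) \<longlonglongrightarrow> 0" by simp
  have "(\<lambda>k. norm ((1 / \<delta> k) *\<^sub>R (gH (x (Suc k)) - gH (x k)))) \<longlonglongrightarrow> 0"
    by (rule tendsto_sandwich[OF _ _ tendsto_const lim]) (use K in auto)
  then have "(\<lambda>k. (1 / \<delta> k) *\<^sub>R (gH (x (Suc k)) - gH (x k))) \<longlonglongrightarrow> 0"
    by (rule tendsto_norm_zero_cancel)
  then have "(\<lambda>k. - ((1 / \<delta> k) *\<^sub>R (gH (x (Suc k)) - gH (x k))) - gE (x k)) \<longlonglongrightarrow> - 0 - gE xs"
    by (intro tendsto_diff tendsto_minus gE_tendsto assms)
  moreover have "- ((1 / \<delta> k) *\<^sub>R (gH (x (Suc k)) - gH (x k))) - gE (x k)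
      = (\<mu> k + \<beta>) *\<^sub>R p (Suc k) - \<mu> k *\<^sub>R p k" for k
    unfolding step by simp
  ultimately show ?thesis by simp
qed

text \<open>Without convergence of \<open>p\<close>: its increments have a limit, and a nonzero one would make the
  bounded sequence \<open>p\<close> drift off to infinity.\<close>

lemma critical_point_unregularized:
  assumes "x \<longlonglongrightarrow> xs" and "\<beta> = 0"
  shows "gE xs = 0"
proof -
  have "(\<lambda>k. inverse (\<mu> k) *\<^sub>R ((\<mu> k + \<beta>) *\<^sub>R p (Suc k) - \<mu> k *\<^sub>R p k)) \<longlonglongrightarrow> inverse \<mu>' *\<^sub>R (- gE xs)"
    using \<mu>'_pos by (intro tendsto_scaleR tendsto_inverse \<mu>_tendsto step_tendsto assms) simp
  moreover have "inverse (\<mu> k) *\<^sub>R ((\<mu> k + \<beta>) *\<^sub>R p (Suc k) - \<mu> k *\<^sub>R p k) = p (Suc k) - p k" for k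
    using \<mu>_pos[of k] assms(2) by (simp flip: scaleR_diff_right)
  ultimately have "(\<lambda>k. p (Suc k) - p k) \<longlonglongrightarrow> inverse \<mu>' *\<^sub>R (- gE xs)" by simp
  from bounded_increments_limit_zero[OF p_bdd this] show ?thesis using \<mu>'_pos by simp
qed

lemma critical_point_regularized:
  assumes "x \<longlonglongrightarrow> xs" and p: "p \<longlonglongrightarrow> ps"
  shows "gE xs + \<beta> *\<^sub>R ps = 0" "ps \<in> convex_subdiff (\<lambda>z. ereal (R z)) xs"
proof -
  have "(\<lambda>k. (\<mu> k + \<beta>) *\<^sub>R p (Suc k) - \<mu> k *\<^sub>R p k) \<longlonglongrightarrow> (\<mu>' + \<beta>) *\<^sub>R ps - \<mu>' *\<^sub>R ps"
    by (intro tendsto_diff tendsto_scaleR tendsto_add \<mu>_tendsto tendsto_const p LIMSEQ_Suc[OF p])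
  from LIMSEQ_unique[OF step_tendsto[OF assms(1)] this]
  show "gE xs + \<beta> *\<^sub>R ps = 0"
    by (simp add: scaleR_add_left) (metis add.right_inverse)
  show "ps \<in> convex_subdiff (\<lambda>z. ereal (R z)) xs" by (rule subgrad_closed[OF assms subgrad])
qed

text \<open>Strong convexity of the conjugate bounds each increment of \<open>p\<close> by
  \<open>1 / s\<close> times that of \<open>x\<close>, so finite length passes from \<open>x\<close>
  to \<open>p\<close>.\<close>

lemma p_convergent:
  assumes "locally_strongly_convex (convex_conjugate (\<lambda>z. ereal (R z)))"
  obtains ps where "p \<longlonglongrightarrow> ps"
proof -
  let ?R = "convex_conjugate (\<lambda>z. ereal (R z))"
  let ?S = "convex hull (range p)"
  have pR: "?R (p k) = ereal (x k \<bullet> p k - R (x k))" for k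
    by (rule convex_conjugate_at_subgradient[OF subgrad])
  have S: "?S \<subseteq> edom ?R"
    by (rule hull_minimal) (auto simp: convex_edom_conjugate, simp add: edom_def pR)
  then have "strongly_convex_on ?S (\<lambda>y. real_of_ereal (?R y))"
    using assms p_bdd unfolding locally_strongly_convex_def
    by (simp add: bounded_convex_hull)
  then obtain s where s: "s > 0" "\<And>q q' t. q \<in> ?S \<Longrightarrow> q' \<in> ?S \<Longrightarrow> 0 \<le> t \<Longrightarrow> t \<le> 1 \<Longrightarrow>
      real_of_ereal (?R ((1 - t) *\<^sub>R q + t *\<^sub>R q')) \<le> (1 - t) * real_of_ereal (?R q)
        + t * real_of_ereal (?R q') - s / 2 * t * (1 - t) * (norm (q - q'))\<^sup>2"
    unfolding strongly_convex_on_def by (metis atLeastAtMost_iff)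
  have mono: "(x i \<bullet> p i - R (x i)) + x i \<bullet> (p j - p i) + s / 2 * (norm (p j - p i))\<^sup>2
      \<le> x j \<bullet> p j - R (x j)" for i j
  proof (rule conjugate_strong_monotone)
    fix t :: real assume t: "0 < t" "t < 1"
    have pS: "p k \<in> ?S" for k by (simp add: hull_inc)
    let ?q = "(1 - t) *\<^sub>R p i + t *\<^sub>R p j"
    have "?q \<in> ?S" using t convex_convex_hull[of "range p"] pS by (simp add: convex_alt)
    then have "?R ?q < \<infinity>" using S by (auto simp: edom_def)
    moreover have "?R ?q \<noteq> - \<infinity>" using convex_conjugate_ge[of "0::'a" ?q R] by auto
    ultimately have "?R ?q = ereal (real_of_ereal (?R ?q))" by (cases "?R ?q") auto
    also have "\<dots> \<le> ereal ((1 - t) * (x i \<bullet> p i - R (x i)) + t * (x j \<bullet> p j - R (x j))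
        - s / 2 * t * (1 - t) * (norm (p i - p j))\<^sup>2)"
      using s(2)[OF pS[of i] pS[of j], of t] t by (simp add: pR)
    finally show "?R ?q \<le> ereal ((1 - t) * (x i \<bullet> p i - R (x i)) + t * (x j \<bullet> p j - R (x j))
        - s / 2 * t * (1 - t) * (norm (p i - p j))\<^sup>2)" .
  qed
  have "norm (p (Suc k) - p k) \<le> norm (x (Suc k) - x k) / s" for k
  proof -
    let ?d = "p (Suc k) - p k"
    \<comment> \<open>Adding the inequality for the exchanged indices cancels the conjugate values
      and leaves strong monotonicity.\<close>
    have "s * (norm ?d)\<^sup>2 \<le> (x (Suc k) - x k) \<bullet> ?d"
      using mono[of k "Suc k"] mono[of "Suc k" k] by (simp add: norm_minus_commute algebra_simps)
    also have "\<dots> \<le> norm (x (Suc k) - x k) * norm ?d" by (rule norm_cauchy_schwarz)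
    finally have "s * norm ?d \<le> norm (x (Suc k) - x k)"
      by (cases "?d = 0") (auto simp: power2_eq_square)
    then show ?thesis using s(1) by (simp add: field_simps)
  qed
  then have "summable (\<lambda>k. norm (p (Suc k) - p k))"
    by (intro summable_comparison_test'[OF summable_divide[OF finite_length, of s]]) simp
  then show ?thesis by (rule convergent_of_finite_length[unfolded convergent_def, THEN exE]) (rule that)
qed

end

section \<open>From the extended-real iteration to the locale\<close>

text \<open>The update formula is the optimality condition of the subproblem:
  \<open>(\<mu> + \<beta>) q'\<close> is minus the gradient at \<open>u\<close> of its smooth part,
  so Fermat's rule makes \<open>q'\<close> a subgradient.\<close>

lemma lbreif_step_subgradient:
  fixes h E R :: "'a::euclidean_space \<Rightarrow> real"
  assumes R: "convex_on UNIV R" and h: "GDERIV h u :> gu" and gu: "egrad (\<lambda>z. ereal (h z)) u = gu"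
    and pos: "0 \<le> \<beta>" "0 < \<delta>" "0 < \<mu>"
    and min: "is_arg_min (lbreif_objective (\<lambda>z. ereal (h z)) (\<lambda>z. ereal (R z)) (\<lambda>z. ereal (E z))
        \<beta> \<delta> \<mu> y q) (\<lambda>_. True) u"
    and q': "(\<mu> + \<beta>) *\<^sub>R q' = \<mu> *\<^sub>R q
        - (1 / \<delta>) *\<^sub>R (gu - egrad (\<lambda>z. ereal (h z)) y) - egrad (\<lambda>z. ereal (E z)) y"
  shows "q' \<in> convex_subdiff (\<lambda>z. ereal (R z)) u"
  unfolding mem_convex_subdiff_real
proof
  fix z
  define gE where "gE = egrad (\<lambda>z. ereal (E z)) y"
  define gy where "gy = egrad (\<lambda>z. ereal (h z)) y"
  \<comment> \<open>\<open>\<psi>\<close> gathers the differentiable terms of the objective; up to a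
    constant, \<open>(\<beta> + \<mu>) * R\<close> is left.\<close>
  define \<psi> where "\<psi> z = gE \<bullet> z + (1 / \<delta>) * (h z - gy \<bullet> z) - \<mu> * (q \<bullet> z)" for z
  have obj: "lbreif_objective (\<lambda>z. ereal (h z)) (\<lambda>z. ereal (R z)) (\<lambda>z. ereal (E z)) \<beta> \<delta> \<mu> y q z
      = ereal ((\<beta> + \<mu>) * R z + \<psi> z
          - (gE \<bullet> y + (1 / \<delta>) * (h y - gy \<bullet> y) + \<mu> * (R y - q \<bullet> y)))" for z
    unfolding lbreif_objective_def bregman_def bregman_sub_def \<psi>_def gE_def[symmetric] gy_def[symmetric]
    by (simp add: algebra_simps inner_diff_right diff_divide_distrib add_divide_distrib)
  have "GDERIV \<psi> u :> gE + (1 / \<delta>) *\<^sub>R (gu - gy) - \<mu> *\<^sub>R q"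
    using h pos(2) unfolding gderiv_def \<psi>_def
    by (auto intro!: derivative_eq_intros simp: fun_eq_iff algebra_simps inner_commute)
  also have "gE + (1 / \<delta>) *\<^sub>R (gu - gy) - \<mu> *\<^sub>R q = - ((\<mu> + \<beta>) *\<^sub>R q')"
    unfolding q' gE_def gy_def by simp
  finally have \<psi>: "GDERIV \<psi> u :> - ((\<mu> + \<beta>) *\<^sub>R q')" .
  have "(\<beta> + \<mu>) * R u + \<psi> u \<le> (\<beta> + \<mu>) * R z + \<psi> z" for z
    using min unfolding is_arg_min_linorder obj by auto
  moreover have "convex_on UNIV (\<lambda>z. (\<beta> + \<mu>) * R z)"
    using R pos by (intro convex_on_cmul) auto
  ultimately have "(\<beta> + \<mu>) * R u - (- ((\<mu> + \<beta>) *\<^sub>R q')) \<bullet> (z - u) \<le> (\<beta> + \<mu>) * R z"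
    using minimizer_convex_plus_smooth[OF _ \<psi>] by blast
  then have "(\<beta> + \<mu>) * (R u + q' \<bullet> (z - u)) \<le> (\<beta> + \<mu>) * R z"
    by (simp add: algebra_simps)
  then show "R u + q' \<bullet> (z - u) \<le> R z" using pos by (simp add: mult_le_cancel_left_pos)
qed

lemma ereal_of_full_domain:
  assumes "proper_fun f" "edom f = UNIV"
  shows "f = (\<lambda>z. ereal (real_of_ereal (f z)))"
proof
  fix z
  have "f z < \<infinity>" "f z \<noteq> - \<infinity>" using assms by (auto simp: edom_def proper_fun_def)
  then show "f z = ereal (real_of_ereal (f z))" by (cases "f z") auto
qed

lemma bregman_real:
  "bregman (\<lambda>z. ereal (h z)) x y = ereal (h x - h y - egrad (\<lambda>z. ereal (h z)) y \<bullet> (x - y))"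
  by (simp add: bregman_def bregman_sub_def)

text \<open>The quotients are bounded below by 0, so the real infimum lies below each of them. In
  the trivial space there are no quotients, and only the case \<open>x = y\<close> occurs.\<close>

lemma sym_coeff_le:
  fixes h :: "'a::real_inner \<Rightarrow> real"
  assumes pos: "\<And>x y. x \<noteq> y \<Longrightarrow> 0 < h x - h y - g y \<bullet> (x - y)"
    and g: "\<And>y. egrad (\<lambda>z. ereal (h z)) y = g y"
  shows "sym_coeff (\<lambda>z. ereal (h z)) * (h x - h y - g y \<bullet> (x - y)) \<le> h y - h x - g x \<bullet> (y - x)"
proof (cases "x = y")
  case False
  let ?q = "\<lambda>x y. (h x - h y - g y \<bullet> (x - y)) / (h y - h x - g x \<bullet> (y - x))"
  have eq: "sym_coeff (\<lambda>z. ereal (h z)) = Inf {?q x y | x y. x \<noteq> y}"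
    by (simp add: sym_coeff_def bregman_real g edom_def)
  have "bdd_below {?q x y | x y. x \<noteq> y}"
    by (intro bdd_belowI[of _ 0]) (auto intro!: divide_nonneg_nonneg less_imp_le[OF pos])
  then have "sym_coeff (\<lambda>z. ereal (h z)) \<le> ?q y x"
    unfolding eq using False by (intro cInf_lower) auto
  then show ?thesis using pos[OF False] by (simp add: pos_le_divide_eq)
qed simp

theorem theorem4p2:
  fixes h R E :: "'a::euclidean_space \<Rightarrow> ereal"
    and L \<beta> \<mu>' \<omega> \<tau> :: real
    and \<delta> \<mu> :: "nat \<Rightarrow> real"
    and x p :: "nat \<Rightarrow> 'a"
  assumes h_legendre: "legendre_type h"
    and h_strong: "strongly_convex_on (edom h) (\<lambda>z. real_of_ereal (h z))"
    and h_closed: "closure (edom h) = edom h"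
    and R_nonneg: "\<And>z. 0 \<le> R z"
    and R_convex: "proper_fun R" "lsc_fun R" "econvex R"
    and R_dom_sub: "interior (edom h) \<subseteq> {z. convex_subdiff R z \<noteq> {}}"
    and R_dom: "edom R \<inter> interior (edom h) \<noteq> {}"
    and E_proper: "proper_fun E" "lsc_fun E"
    and E_dom: "edom h \<subseteq> edom E"
    and E_diff: "ediff_on (interior (edom h)) E"
    and E_cont: "continuous_on (edom h) E"
    and L_pos: "0 < L"
    and L_smad: "convex_on (interior (edom h)) (\<lambda>z. L * real_of_ereal (h z) - real_of_ereal (E z))"
    and beta: "0 \<le> \<beta>"
    and f_bdd_below: "- \<infinity> < (INF z\<in>edom h. f_reg E R \<beta> z)"
    and D_h_conv: "\<And>y z. (\<And>k. y k \<in> interior (edom h)) \<Longrightarrow> z \<in> edom h \<Longrightarrow> y \<longlonglongrightarrow> z \<Longrightarrow>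
          (\<lambda>k::nat. bregman h z (y k)) \<longlonglongrightarrow> 0"
    and D_R_conv: "\<And>y q z. (\<And>k. y k \<in> interior (edom h)) \<Longrightarrow> (\<And>k. q k \<in> convex_subdiff R (y k)) \<Longrightarrow>
          z \<in> edom h \<Longrightarrow> y \<longlonglongrightarrow> z \<Longrightarrow> (\<lambda>k::nat. bregman_sub R (q k) z (y k)) \<longlonglongrightarrow> 0"
    and R_sub_bdd: "\<And>U. bounded U \<Longrightarrow> \<exists>C>0. \<forall>z\<in>U. \<forall>q\<in>convex_subdiff R z. norm q \<le> C"
    and h_lip: "loc_grad_lipschitz h"
    and E_lip: "loc_grad_lipschitz E"
    and level_bdd: "bounded {z. f_reg E R \<beta> z \<le> f_reg E R \<beta> (x 0)}"
    and mu_pos: "0 < \<mu>'"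
    and omega: "0 < \<omega>" "\<omega> < 1 + sym_coeff h"
    and delta: "\<And>k. 0 < \<delta> k" "\<And>k. \<delta> k < (1 + sym_coeff h - \<omega>) / L"
    and tau: "0 < \<tau>" "\<And>k. \<tau> < \<delta> (Suc k) * \<mu> (Suc k)"
      "\<And>k. \<delta> (Suc k) * \<mu> (Suc k) \<le> \<delta> k * \<mu> k"
    and mu_ge: "\<And>k. \<mu>' \<le> \<mu> k"
    and mu_sum: "summable (\<lambda>k. \<mu> k - \<mu>')"
    and F_KL: "KL_function (F_surrogate E R \<beta> \<mu>')"
    and iter: "lbreif_iteration h R E \<beta> \<delta> \<mu> x p"
  shows "summable (\<lambda>k. norm (x (Suc k) - x k)) \<and>
    (\<beta> = 0 \<longrightarrow> (\<exists>xs. x \<longlonglongrightarrow> xs \<and> has_egrad E xs 0)) \<and>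
    (locally_strongly_convex (convex_conjugate R) \<longrightarrow>
       (\<exists>xs ps. x \<longlonglongrightarrow> xs \<and> p \<longlonglongrightarrow> ps \<and>
          (\<exists>g. has_egrad E xs g \<and> 0 \<in> (\<lambda>q. g + \<beta> *\<^sub>R q) ` convex_subdiff R xs)))"
proof -
  define H where "H = (\<lambda>z. real_of_ereal (h z))"
  define Rr where "Rr = (\<lambda>z. real_of_ereal (R z))"
  define Er where "Er = (\<lambda>z. real_of_ereal (E z))"
  have dom_h: "edom h = UNIV"
    by (rule legendre_loc_grad_lipschitz_full_domain[OF h_legendre h_lip])
  have dom_E: "edom E = UNIV" using E_dom dom_h by auto
  \<comment> \<open>A point with a subgradient lies in the domain, so \<open>R\<close> is finite
    everywhere.\<close>
  have dom_R: "edom R = UNIV" using R_dom_sub dom_h by (fastforce simp: convex_subdiff_def)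
  have h: "h = (\<lambda>z. ereal (H z))" unfolding H_def
    using h_legendre dom_h by (intro ereal_of_full_domain) (auto simp: legendre_type_def)
  have R: "R = (\<lambda>z. ereal (Rr z))" unfolding Rr_def
    by (intro ereal_of_full_domain R_convex dom_R)
  have E: "E = (\<lambda>z. ereal (Er z))" unfolding Er_def
    by (intro ereal_of_full_domain E_proper dom_E)
  have h_egrad: "has_egrad h z (egrad h z)" for z
    using h_lip dom_h by (intro has_egrad_egrad[of UNIV]) (auto simp: loc_grad_lipschitz_def)
  have E_egrad: "has_egrad E z (egrad E z)" for z
    using E_diff dom_h by (intro has_egrad_egrad[of UNIV]) auto
  have H_grad: "GDERIV H z :> egrad h z" for z using h_egrad by (simp add: has_egrad_def H_def)
  have Er_grad: "GDERIV Er z :> egrad E z" for z using E_egrad by (simp add: has_egrad_def Er_def)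
  obtain c where c: "c > 0" "\<And>y z t. 0 < t \<Longrightarrow> t < 1 \<Longrightarrow> H ((1 - t) *\<^sub>R y + t *\<^sub>R z)
      \<le> (1 - t) * H y + t * H z - c / 2 * t * (1 - t) * (norm (y - z))\<^sup>2"
    using h_strong unfolding dom_h strongly_convex_on_def H_def[symmetric]
    by (metis UNIV_I atLeastAtMost_iff less_imp_le)
  have H_strong: "H y + egrad h y \<bullet> (z - y) + c / 2 * (norm (z - y))\<^sup>2 \<le> H z" for y z
    by (rule gderiv_strong_tangent[OF H_grad c(2)])
  have D_pos: "0 < H z - H y - egrad h y \<bullet> (z - y)" if "z \<noteq> y" for y z
  proof -
    have "0 < c / 2 * (norm (z - y))\<^sup>2" using c(1) that by simp
    then show ?thesis using H_strong[of y z] by linarith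
  qed
  have H_sym: "sym_coeff h * (H z - H y - egrad h y \<bullet> (z - y)) \<le> H y - H z - egrad h z \<bullet> (y - z)" for y z
    using sym_coeff_le[of H "egrad h" z y] D_pos by (simp flip: h)
  have descent: "Er z \<le> Er y + egrad E y \<bullet> (z - y) + L * (H z - H y - egrad h y \<bullet> (z - y))" for y z
  proof -
    have grad: "GDERIV (\<lambda>z. L * H z - Er z) y :> L *\<^sub>R egrad h y - egrad E y"
      using H_grad[of y] Er_grad[of y] unfolding gderiv_def
      by (auto intro!: derivative_eq_intros simp: inner_diff_right)
    have conv: "convex_on UNIV (\<lambda>z. L * H z - Er z)"
      using L_smad by (simp add: dom_h H_def Er_def)
    \<comment> \<open>The tangent inequality with modulus 0; rearranged, it is the descent
      inequality.\<close>
    have "(L * H y - Er y) + (L *\<^sub>R egrad h y - egrad E y) \<bullet> (z - y) + 0 / 2 * (norm (z - y))\<^sup>2 \<le> L * H z - Er z"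
      by (rule gderiv_strong_tangent[OF grad]) (use convex_onD[OF conv] in simp)
    then show ?thesis by (simp add: algebra_simps inner_diff_left)
  qed
  have R_conv: "convex_on UNIV Rr" using R_convex(3) by (simp add: econvex_def dom_R Rr_def)
  have freg: "f_reg E R \<beta> z = ereal (Er z + \<beta> * Rr z)" for z by (simp add: f_reg_def E R)
  obtain m where m: "ereal m < (INF z\<in>edom h. f_reg E R \<beta> z)"
    using ereal_dense2[OF f_bdd_below] by blast
  have f_below: "m \<le> Er z + \<beta> * Rr z" for z
  proof -
    have "(INF z\<in>edom h. f_reg E R \<beta> z) \<le> f_reg E R \<beta> z" by (rule INF_lower) (simp add: dom_h)
    then have "ereal m \<le> f_reg E R \<beta> z" using m by (meson less_imp_le order_trans)
    then show ?thesis by (simp add: freg)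
  qed
  have \<mu>_pos: "0 < \<mu> k" for k using mu_ge[of k] mu_pos by simp
  have min: "is_arg_min (lbreif_objective h R E \<beta> (\<delta> k) (\<mu> k) (x k) (p k)) (\<lambda>_. True) (x (Suc k))"
    and p_Suc: "p (Suc k) = (\<mu> k / (\<mu> k + \<beta>)) *\<^sub>R p k - (1 / (\<delta> k * (\<mu> k + \<beta>))) *\<^sub>R
        (egrad h (x (Suc k)) - egrad h (x k) + \<delta> k *\<^sub>R egrad E (x k))" for k
    using iter by (auto simp: lbreif_iteration_def)
  have step: "(\<mu> k + \<beta>) *\<^sub>R p (Suc k) = \<mu> k *\<^sub>R p k
      - (1 / \<delta> k) *\<^sub>R (egrad h (x (Suc k)) - egrad h (x k)) - egrad E (x k)" for k
    using \<mu>_pos[of k] beta delta(1)[of k] by (simp add: p_Suc scaleR_diff_right scaleR_add_right)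
  have subgrad: "p k \<in> convex_subdiff (\<lambda>z. ereal (Rr z)) (x k)" for k
  proof (cases k)
    case 0
    then show ?thesis using iter by (simp add: lbreif_iteration_def flip: R)
  next
    case (Suc j)
    show ?thesis unfolding Suc
    proof (rule lbreif_step_subgradient[OF R_conv H_grad _ beta delta(1) \<mu>_pos])
      show "is_arg_min (lbreif_objective (\<lambda>z. ereal (H z)) (\<lambda>z. ereal (Rr z)) (\<lambda>z. ereal (Er z))
        \<beta> (\<delta> j) (\<mu> j) (x j) (p j)) (\<lambda>_. True) (x (Suc j))"
        using min[of j] by (simp flip: h E R)
    qed (use step[of j] in \<open>simp_all flip: h E\<close>)
  qed
  \<comment> \<open>The bound by \<open>\<tau>\<close> is assumed from index 1 on; monotonicity of
    the products carries it to index 0.\<close>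
  have \<tau>_lt: "\<tau> < \<delta> k * \<mu> k" for k
    using tau(2) tau(3)[of 0] by (cases k) (auto intro: less_le_trans)
  interpret bregman_iteration H Rr Er "egrad h" "egrad E" c L \<beta> "sym_coeff h" \<mu>' \<omega> \<tau> m \<delta> \<mu> x p
  proof (unfold_locales, goal_cases)
    show "bounded {z. Er z + \<beta> * Rr z \<le> Er (x 0) + \<beta> * Rr (x 0)}"
      using level_bdd by (simp add: freg)
    show "\<exists>l>0. \<forall>y\<in>U. \<forall>z\<in>U. norm (egrad h y - egrad h z) \<le> l * norm (y - z)" if "bounded U" for U
      using h_lip that by (simp add: loc_grad_lipschitz_def dom_h)
    show "\<exists>l>0. \<forall>y\<in>U. \<forall>z\<in>U. norm (egrad E y - egrad E z) \<le> l * norm (y - z)" if "bounded U" for U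
      using E_lip that by (simp add: loc_grad_lipschitz_def dom_E)
    show "\<exists>C>0. \<forall>z\<in>U. \<forall>q\<in>convex_subdiff (\<lambda>z. ereal (Rr z)) z. norm q \<le> C" if "bounded U" for U
      using R_sub_bdd[OF that] by (simp flip: R)
    show "KL_at (F_surrogate (\<lambda>z. ereal (Er z)) (\<lambda>z. ereal (Rr z)) \<beta> \<mu>') s"
      if "limiting_subdiff (F_surrogate (\<lambda>z. ereal (Er z)) (\<lambda>z. ereal (Rr z)) \<beta> \<mu>') s \<noteq> {}" for s
      using F_KL that unfolding KL_function_def E[symmetric] R[symmetric] by blast
  qed (fact c(1) H_strong H_sym Er_grad descent R_conv f_below L_pos beta mu_pos omega(1) delta
      tau(1) \<tau>_lt mu_ge mu_sum subgrad step)+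
  obtain xs where xs: "x \<longlonglongrightarrow> xs" by (rule x_convergent)
  have b: "has_egrad E xs 0" if "\<beta> = 0"
    using critical_point_unregularized[OF xs that] E_egrad[of xs] by simp
  have c: "\<exists>ps. p \<longlonglongrightarrow> ps \<and> (\<exists>g. has_egrad E xs g \<and> 0 \<in> (\<lambda>q. g + \<beta> *\<^sub>R q) ` convex_subdiff R xs)"
    if strong: "locally_strongly_convex (convex_conjugate R)"
  proof -
    obtain ps where ps: "p \<longlonglongrightarrow> ps" by (rule p_convergent[OF strong[unfolded R]])
    from critical_point_regularized[OF xs ps]
    have "0 = egrad E xs + \<beta> *\<^sub>R ps" "ps \<in> convex_subdiff R xs" by (simp_all flip: R)
    then show ?thesis using ps E_egrad[of xs] by blast
  qed
  show ?thesis using finite_length xs b c by blast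
qed

end
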